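(* Let $B(t)=(B_0(t),B_1(t),\dots,B_d(t))'$ be a $(d+1)$-dimensional mean-zero Brownian motion with covariance matrix $\Sigma=(\sigma_{ij})_{0\le i,j\le d}$, and let $\hat B(t)=(B_1(t),\dots,B_d(t))'$. Let $$\mathcal I=\int_0^1(B_0(1)-B_0(s))\,I\,d\hat B(s),$$ where $I$ is the $d\times d$ identity matrix and the integral denotes $B_0(1)\hat B(1)-\int_0^1B_0(s)\,d\hat B(s)$ with the last integral an It\^o integral. Then for $1\le i,j\le d$ the $(i,j)$th component of the covariance matrix of $\mathcal I$ is $$\mathrm{Cov}(\mathcal I)_{ij}=\frac{\sigma_{00}\,\sigma_{ij}}{2}.$$
   Context: A (mean-zero) Brownian motion with covariance matrix $\Sigma$ starts at $B(0)=0$ and has $\mathrm{Cov}(B(t))=t\Sigma$; $'$ denotes transpose. *)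

theory Defs
  imports "HOL-Probability.Probability"
begin

section \<open>Normal random vectors and covariance matrices\<close>

text \<open>The variance \<open>v\<close> may be zero; the law is then the point mass at \<open>\<mu>\<close>.\<close>

definition normal_rv :: "'w measure \<Rightarrow> real \<Rightarrow> real \<Rightarrow> ('w \<Rightarrow> real) \<Rightarrow> bool" where
  "normal_rv M \<mu> v X \<longleftrightarrow>
     X \<in> borel_measurable M \<and>
     (v = 0 \<and> (AE \<omega> in M. X \<omega> = \<mu>) \<or>
      v > 0 \<and> distributed M lborel X (\<lambda>x. ennreal (normal_density \<mu> (sqrt v) x)))"

text \<open>Possibly degenerate multivariate normal law: \<open>\<Sigma>\<close> is symmetric and every linear functional
  of \<open>X\<close> is normal, which forces \<open>\<Sigma>\<close> to be positive semidefinite. Symmetry has to be required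
  separately, because the quadratic form only sees the symmetric part of \<open>\<Sigma>\<close>.\<close>

definition multivariate_normal ::
  "'w measure \<Rightarrow> real ^ 'n \<Rightarrow> real ^ 'n ^ 'n \<Rightarrow> ('w \<Rightarrow> real ^ 'n) \<Rightarrow> bool" where
  "multivariate_normal M \<mu> \<Sigma> X \<longleftrightarrow>
     X \<in> borel_measurable M \<and> transpose \<Sigma> = \<Sigma> \<and>
     (\<forall>u. normal_rv M (u \<bullet> \<mu>) (u \<bullet> (\<Sigma> *v u)) (\<lambda>\<omega>. u \<bullet> X \<omega>))"

definition covariance_matrix :: "'w measure \<Rightarrow> ('w \<Rightarrow> real ^ 'n) \<Rightarrow> real ^ 'n ^ 'n" where
  "covariance_matrix M X =
     (\<chi> i j. \<integral>\<omega>. (X \<omega> $ i - (\<integral>\<omega>'. X \<omega>' $ i \<partial>M)) * (X \<omega> $ j - (\<integral>\<omega>'. X \<omega>' $ j \<partial>M)) \<partial>M)"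


section \<open>Brownian motion\<close>

text \<open>Processes are indexed by \<open>real\<close>; only the times \<open>t \<ge> 0\<close> matter.\<close>

definition natural_filtration ::
  "'w measure \<Rightarrow> (real \<Rightarrow> 'w \<Rightarrow> 'b::topological_space) \<Rightarrow> real \<Rightarrow> 'w measure" where
  "natural_filtration M X t =
     sigma (space M) (\<Union>s\<in>{0..t}. {X s -` A \<inter> space M |A. A \<in> sets borel})"

definition brownian_motion ::
  "'w measure \<Rightarrow> real ^ 'n ^ 'n \<Rightarrow> (real \<Rightarrow> 'w \<Rightarrow> real ^ 'n) \<Rightarrow> bool" where
  "brownian_motion M \<Sigma> B \<longleftrightarrow>
     prob_space M \<and>
     (\<forall>t\<ge>0. B t \<in> borel_measurable M) \<and>
     (AE \<omega> in M. B 0 \<omega> = 0) \<and>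
     (\<forall>s t. 0 \<le> s \<and> s \<le> t \<longrightarrow>
        multivariate_normal M 0 ((t - s) *\<^sub>R \<Sigma>) (\<lambda>\<omega>. B t \<omega> - B s \<omega>)) \<and>
     (\<forall>s t. 0 \<le> s \<and> s \<le> t \<longrightarrow>
        prob_space.indep_set M (sets (natural_filtration M B s))
          (sets (vimage_algebra (space M) (\<lambda>\<omega>. B t \<omega> - B s \<omega>) borel))) \<and>
     (AE \<omega> in M. continuous_on {0..} (\<lambda>t. B t \<omega>))"


section \<open>The Ito integral\<close>

text \<open>A simple process on \<open>[0, T]\<close> is given by times \<open>0 \<le> t 0 \<le> \<dots> \<le> t n \<le> T\<close> and
  square-integrable variables \<open>\<xi> k\<close>, known at time \<open>t k\<close>, which are its values on
  \<open>(t k, t (k + 1)]\<close>.\<close>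

definition simple_process ::
  "'w measure \<Rightarrow> (real \<Rightarrow> 'w measure) \<Rightarrow> real \<Rightarrow> nat \<Rightarrow> (nat \<Rightarrow> real) \<Rightarrow> (nat \<Rightarrow> 'w \<Rightarrow> real) \<Rightarrow> bool"
  where
  "simple_process M F T n t \<xi> \<longleftrightarrow>
     (\<forall>k\<le>n. 0 \<le> t k \<and> t k \<le> T) \<and>
     (\<forall>k<n. t k \<le> t (Suc k)) \<and>
     (\<forall>k<n. \<xi> k \<in> borel_measurable (F (t k)) \<and> integrable M (\<lambda>\<omega>. (\<xi> k \<omega>)\<^sup>2))"

definition simple_process_value ::
  "nat \<Rightarrow> (nat \<Rightarrow> real) \<Rightarrow> (nat \<Rightarrow> 'w \<Rightarrow> real) \<Rightarrow> real \<Rightarrow> 'w \<Rightarrow> real" where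
  "simple_process_value n t \<xi> s \<omega> = (\<Sum>k<n. \<xi> k \<omega> * indicator {t k<..t (Suc k)} s)"

definition simple_integral ::
  "nat \<Rightarrow> (nat \<Rightarrow> real) \<Rightarrow> (nat \<Rightarrow> 'w \<Rightarrow> real) \<Rightarrow> (real \<Rightarrow> 'w \<Rightarrow> real) \<Rightarrow> 'w \<Rightarrow> real" where
  "simple_integral n t \<xi> W \<omega> = (\<Sum>k<n. \<xi> k \<omega> * (W (t (Suc k)) \<omega> - W (t k) \<omega>))"

text \<open>The completion makes joint measurability insensitive to the null set of paths on which a
  process with almost surely continuous paths may fail to be continuous.\<close>

definition path_measure :: "'w measure \<Rightarrow> real \<Rightarrow> ('w \<times> real) measure" where
  "path_measure M T = completion (M \<Otimes>\<^sub>M restrict_space lborel {0..T})"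

definition ito_integrand ::
  "'w measure \<Rightarrow> (real \<Rightarrow> 'w measure) \<Rightarrow> real \<Rightarrow> (real \<Rightarrow> 'w \<Rightarrow> real) \<Rightarrow> bool" where
  "ito_integrand M F T H \<longleftrightarrow>
     (\<lambda>(\<omega>, s). H s \<omega>) \<in> borel_measurable (path_measure M T) \<and>
     (\<forall>s\<in>{0..T}. H s \<in> borel_measurable (F s)) \<and>
     (\<integral>\<^sup>+(\<omega>, s). ennreal ((H s \<omega>)\<^sup>2) \<partial>path_measure M T) < \<infinity>"

text \<open>\<open>J\<close> is a version of \<open>\<integral>\<^sub>0\<^sup>T H dW\<close> if it is the \<open>L\<^sup>2(M)\<close>-limit of the integrals of simple
  processes that converge to \<open>H\<close> in \<open>L\<^sup>2\<close> of the product of \<open>M\<close> and Lebesgue measure. When \<open>W\<close> is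
  a Brownian motion with respect to \<open>F\<close>, such a \<open>J\<close> exists for every Ito integrand and is
  almost surely unique.\<close>

definition has_ito_integral ::
  "'w measure \<Rightarrow> (real \<Rightarrow> 'w measure) \<Rightarrow> (real \<Rightarrow> 'w \<Rightarrow> real) \<Rightarrow> real \<Rightarrow> (real \<Rightarrow> 'w \<Rightarrow> real) \<Rightarrow>
    ('w \<Rightarrow> real) \<Rightarrow> bool" where
  "has_ito_integral M F W T H J \<longleftrightarrow>
     ito_integrand M F T H \<and>
     J \<in> borel_measurable M \<and>
     (\<exists>n t \<xi>.
        (\<forall>m. simple_process M F T (n m) (t m) (\<xi> m)) \<and>
        (\<lambda>m. \<integral>\<^sup>+(\<omega>, s). ennreal ((simple_process_value (n m) (t m) (\<xi> m) s \<omega> - H s \<omega>)\<^sup>2)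
               \<partial>path_measure M T) \<longlonglongrightarrow> 0 \<and>
        (\<lambda>m. \<integral>\<^sup>+\<omega>. ennreal ((simple_integral (n m) (t m) (\<xi> m) W \<omega> - J \<omega>)\<^sup>2) \<partial>M) \<longlonglongrightarrow> 0)"

definition ito_integral ::
  "'w measure \<Rightarrow> (real \<Rightarrow> 'w measure) \<Rightarrow> (real \<Rightarrow> 'w \<Rightarrow> real) \<Rightarrow> real \<Rightarrow> (real \<Rightarrow> 'w \<Rightarrow> real) \<Rightarrow>
    'w \<Rightarrow> real" where
  "ito_integral M F W T H = (SOME J. has_ito_integral M F W T H J)"

text \<open>Scalar integrand, vector-valued integrator.\<close>

definition ito_integral_vec ::
  "'w measure \<Rightarrow> (real \<Rightarrow> 'w measure) \<Rightarrow> (real \<Rightarrow> 'w \<Rightarrow> real ^ 'n) \<Rightarrow> real \<Rightarrow>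
    (real \<Rightarrow> 'w \<Rightarrow> real) \<Rightarrow> 'w \<Rightarrow> real ^ 'n" where
  "ito_integral_vec M F W T H \<omega> = (\<chi> i. ito_integral M F (\<lambda>s \<omega>'. W s \<omega>' $ i) T H \<omega>)"


section \<open>The integral of a tail increment\<close>

text \<open>Vectors with components \<open>0, 1, \<dots>, d\<close> have type \<open>real ^ 'd option\<close> with \<open>d = CARD('d)\<close>:
  the index \<open>0\<close> is \<open>None\<close>, and the indices \<open>1, \<dots>, d\<close> are the \<open>Some i\<close>.\<close>

definition hat :: "real ^ 'd option \<Rightarrow> real ^ 'd" where
  "hat x = (\<chi> i. x $ Some i)"

text \<open>\<open>\<integral>\<^sub>0\<^sup>1 (B\<^sub>0(1) - B\<^sub>0(s)) I dB\<close> over the components \<open>1, \<dots>, d\<close>, whose integrand anticipates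
  \<open>B\<^sub>0(1)\<close>; by convention this factor is taken out of the integral.\<close>

definition tail_integral ::
  "'w measure \<Rightarrow> (real \<Rightarrow> 'w \<Rightarrow> real ^ 'd option) \<Rightarrow> 'w \<Rightarrow> real ^ 'd" where
  "tail_integral M B \<omega> =
     (B 1 \<omega> $ None) *\<^sub>R hat (B 1 \<omega>)
     - ito_integral_vec M (natural_filtration M B) (\<lambda>s \<omega>'. hat (B s \<omega>')) 1
         (\<lambda>s \<omega>'. B s \<omega>' $ None) \<omega>"

end

theory Submission
  imports Defs
begin

text \<open>
  Write \<open>J\<^sub>i\<close> for the Ito integral of \<open>B\<^sub>0\<close> against \<open>B\<^sub>i\<close> over \<open>[0, 1]\<close>. Integration by parts gives
  \<open>B\<^sub>0(1) B\<^sub>i(1) - J\<^sub>i = \<sigma>\<^sub>0\<^sub>i + \<integral> B\<^sub>i dB\<^sub>0\<close>, where \<open>\<sigma>\<^sub>0\<^sub>i\<close> is the covariation of \<open>B\<^sub>0\<close> and \<open>B\<^sub>i\<close> on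
  \<open>[0, 1]\<close>. So the \<open>i\<close>-th component of the tail integral has mean \<open>\<sigma>\<^sub>0\<^sub>i\<close>, and what is left after
  centring is an integral against the single Brownian motion \<open>B\<^sub>0\<close>. By the Ito isometry the
  covariance of two such integrals is \<open>\<sigma>\<^sub>0\<^sub>0 \<integral> E[B\<^sub>i(s) B\<^sub>j(s)] ds = \<sigma>\<^sub>0\<^sub>0 \<integral> s \<sigma>\<^sub>i\<^sub>j ds = \<sigma>\<^sub>0\<^sub>0 \<sigma>\<^sub>i\<^sub>j / 2\<close>.

  The argument is carried out on Riemann sums over the grid of mesh \<open>1 / 4 ^ m\<close>, where
  integration by parts is an exact algebraic identity (\<open>grid_summation_by_parts\<close>) whose last
  term is the sum of products of increments. That sum converges to \<open>\<sigma>\<^sub>0\<^sub>i\<close> in \<open>L\<^sup>2\<close>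
  (\<open>quadratic_covariation_tendsto\<close>), because its centred terms are orthogonal and their
  second moments are of the order of the squared mesh.

  The integral \<open>J\<^sub>i\<close> is a choice from a set of \<open>L\<^sup>2\<close>-limits, so two facts about it are
  needed: the set is nonempty (\<open>Ito_integral_exists\<close>), and whatever approximating simple
  processes certify a member, the grid sums converge to it as well
  (\<open>grid_integral_tendsto_Ito_integral\<close>). Both follow from the isometry for the difference of two
  simple processes over unrelated partitions (\<open>Ito_isometry_diff\<close>): grid sums are Cauchy, and they
  stay close to any other approximating sequence. Since expectations of products pass to
  \<open>L\<^sup>2\<close>-limits (\<open>tendsto_L2_inner\<close>), the mean and the covariance are limits of those of the grid
  sums (\<open>centred_tail_moments\<close>).
\<close>

section \<open>Square-integrable functions and mean-square convergence\<close>

definition square_integrable :: "'a measure \<Rightarrow> ('a \<Rightarrow> real) \<Rightarrow> bool" where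
  "square_integrable M X \<longleftrightarrow> X \<in> borel_measurable M \<and> integrable M (\<lambda>\<omega>. (X \<omega>)\<^sup>2)"

definition tendsto_L2 :: "'a measure \<Rightarrow> (nat \<Rightarrow> 'a \<Rightarrow> real) \<Rightarrow> ('a \<Rightarrow> real) \<Rightarrow> bool" where
  "tendsto_L2 M X Y \<longleftrightarrow> (\<lambda>m. \<integral>\<^sup>+\<omega>. ennreal ((X m \<omega> - Y \<omega>)\<^sup>2) \<partial>M) \<longlonglongrightarrow> 0"

lemma square_integrable_measurable:
  "square_integrable M X \<Longrightarrow> X \<in> borel_measurable M"
  by (simp add: square_integrable_def)

lemma square_integrable_mult:
  assumes "square_integrable M X" "square_integrable M Y"
  shows "integrable M (\<lambda>\<omega>. X \<omega> * Y \<omega>)"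
proof -
  have [measurable]: "X \<in> borel_measurable M" "Y \<in> borel_measurable M"
    using assms by (auto simp: square_integrable_def)
  have "\<bar>x * y\<bar> \<le> x\<^sup>2 + y\<^sup>2" for x y :: real
  proof -
    have "2 * (\<bar>x\<bar> * \<bar>y\<bar>) \<le> x\<^sup>2 + y\<^sup>2"
      using sum_squares_bound[of "\<bar>x\<bar>" "\<bar>y\<bar>"] by simp
    moreover have "0 \<le> \<bar>x\<bar> * \<bar>y\<bar>" by simp
    ultimately show ?thesis
      unfolding abs_mult by linarith
  qed
  then have bound: "norm (X \<omega> * Y \<omega>) \<le> norm ((X \<omega>)\<^sup>2 + (Y \<omega>)\<^sup>2)" for \<omega>
    by (metis abs_ge_self order_trans real_norm_def)
  have int: "integrable M (\<lambda>\<omega>. (X \<omega>)\<^sup>2 + (Y \<omega>)\<^sup>2)"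
    using assms by (simp add: square_integrable_def)
  show ?thesis
    by (rule Bochner_Integration.integrable_bound[OF int _ AE_I2[OF bound]]) measurable
qed

lemma square_integrable_add:
  assumes "square_integrable M X" "square_integrable M Y"
  shows "square_integrable M (\<lambda>\<omega>. X \<omega> + Y \<omega>)"
proof -
  have "integrable M (\<lambda>\<omega>. (X \<omega>)\<^sup>2 + (Y \<omega>)\<^sup>2 + 2 * (X \<omega> * Y \<omega>))"
    using assms square_integrable_mult[OF assms] by (simp add: square_integrable_def)
  moreover have "(\<lambda>\<omega>. (X \<omega> + Y \<omega>)\<^sup>2) = (\<lambda>\<omega>. (X \<omega>)\<^sup>2 + (Y \<omega>)\<^sup>2 + 2 * (X \<omega> * Y \<omega>))"
    by (auto simp: power2_sum)
  moreover have "(\<lambda>\<omega>. X \<omega> + Y \<omega>) \<in> borel_measurable M"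
    using assms by (intro borel_measurable_add square_integrable_measurable)
  ultimately show ?thesis
    unfolding square_integrable_def by metis
qed

lemma square_integrable_cmult:
  "square_integrable M X \<Longrightarrow> square_integrable M (\<lambda>\<omega>. c * X \<omega>)"
  unfolding square_integrable_def power_mult_distrib
  by (intro conjI borel_measurable_times borel_measurable_const integrable_mult_right) simp_all

lemma square_integrable_diff:
  assumes "square_integrable M X" "square_integrable M Y"
  shows "square_integrable M (\<lambda>\<omega>. X \<omega> - Y \<omega>)"
  using square_integrable_add[OF assms(1) square_integrable_cmult[OF assms(2), of "-1"]] by simp

lemma square_integrable_sum:
  "(\<And>k. k \<in> A \<Longrightarrow> square_integrable M (X k)) \<Longrightarrow> square_integrable M (\<lambda>\<omega>. \<Sum>k\<in>A. X k \<omega>)"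
proof (induction A rule: infinite_finite_induct)
  case (insert x F)
  then show ?case by (simp add: square_integrable_add)
qed (auto simp: square_integrable_def)

lemma (in finite_measure) square_integrable_const: "square_integrable M (\<lambda>_. c)"
  by (simp add: square_integrable_def)

lemma (in finite_measure) integrable_if_square_integrable:
  "square_integrable M X \<Longrightarrow> integrable M X"
  using square_integrable_mult[OF _ square_integrable_const[of 1]] by simp

lemma nn_integral_eq_square_integrable:
  "square_integrable M X \<Longrightarrow> (\<integral>\<^sup>+\<omega>. ennreal ((X \<omega>)\<^sup>2) \<partial>M) = ennreal (\<integral>\<omega>. (X \<omega>)\<^sup>2 \<partial>M)"
  by (intro nn_integral_eq_integral) (auto simp: square_integrable_def)

lemma square_integrableI_nn_integral:
  "X \<in> borel_measurable M \<Longrightarrow> (\<integral>\<^sup>+\<omega>. ennreal ((X \<omega>)\<^sup>2) \<partial>M) < \<infinity> \<Longrightarrow> square_integrable M X"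
  unfolding square_integrable_def by (auto intro!: integrableI_bounded)

lemma Cauchy_Schwarz_square_integrable:
  assumes "square_integrable M X" "square_integrable M Y"
  shows "\<bar>\<integral>\<omega>. X \<omega> * Y \<omega> \<partial>M\<bar> \<le> sqrt ((\<integral>\<omega>. (X \<omega>)\<^sup>2 \<partial>M) * (\<integral>\<omega>. (Y \<omega>)\<^sup>2 \<partial>M))"
proof -
  note [measurable] = square_integrable_measurable[OF assms(1)] square_integrable_measurable[OF assms(2)]
  have int: "integrable M (\<lambda>\<omega>. X \<omega> * Y \<omega>)" by (rule square_integrable_mult[OF assms])
  have "(\<integral>\<^sup>+\<omega>. ennreal \<bar>X \<omega>\<bar> * ennreal \<bar>Y \<omega>\<bar> \<partial>M)\<^sup>2
      \<le> (\<integral>\<^sup>+\<omega>. (ennreal \<bar>X \<omega>\<bar>)\<^sup>2 \<partial>M) * (\<integral>\<^sup>+\<omega>. (ennreal \<bar>Y \<omega>\<bar>)\<^sup>2 \<partial>M)"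
    by (rule Cauchy_Schwarz_nn_integral) auto
  also have "(\<integral>\<^sup>+\<omega>. ennreal \<bar>X \<omega>\<bar> * ennreal \<bar>Y \<omega>\<bar> \<partial>M) = ennreal (\<integral>\<omega>. \<bar>X \<omega> * Y \<omega>\<bar> \<partial>M)"
    using integrable_abs[OF int]
    by (subst nn_integral_eq_integral[symmetric]) (simp_all add: abs_mult ennreal_mult)
  also have "(\<integral>\<^sup>+\<omega>. (ennreal \<bar>X \<omega>\<bar>)\<^sup>2 \<partial>M) = ennreal (\<integral>\<omega>. (X \<omega>)\<^sup>2 \<partial>M)"
    by (simp add: nn_integral_eq_square_integrable[OF assms(1), symmetric] ennreal_power)
  also have "(\<integral>\<^sup>+\<omega>. (ennreal \<bar>Y \<omega>\<bar>)\<^sup>2 \<partial>M) = ennreal (\<integral>\<omega>. (Y \<omega>)\<^sup>2 \<partial>M)"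
    by (simp add: nn_integral_eq_square_integrable[OF assms(2), symmetric] ennreal_power)
  finally have "(\<integral>\<omega>. \<bar>X \<omega> * Y \<omega>\<bar> \<partial>M)\<^sup>2 \<le> (\<integral>\<omega>. (X \<omega>)\<^sup>2 \<partial>M) * (\<integral>\<omega>. (Y \<omega>)\<^sup>2 \<partial>M)"
    by (simp add: ennreal_power ennreal_mult[symmetric] ennreal_le_iff)
  then have "\<bar>\<integral>\<omega>. \<bar>X \<omega> * Y \<omega>\<bar> \<partial>M\<bar> \<le> sqrt ((\<integral>\<omega>. (X \<omega>)\<^sup>2 \<partial>M) * (\<integral>\<omega>. (Y \<omega>)\<^sup>2 \<partial>M))"
    by (metis real_sqrt_abs real_sqrt_le_mono)
  then show ?thesis
    using integral_abs_bound[of M "\<lambda>\<omega>. X \<omega> * Y \<omega>"] by linarith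
qed

lemma nn_integral_square_triangle:
  assumes [measurable]: "X \<in> borel_measurable M" "Y \<in> borel_measurable M" "Z \<in> borel_measurable M"
  shows "(\<integral>\<^sup>+\<omega>. ennreal ((X \<omega> - Z \<omega>)\<^sup>2) \<partial>M)
    \<le> 2 * (\<integral>\<^sup>+\<omega>. ennreal ((X \<omega> - Y \<omega>)\<^sup>2) \<partial>M) + 2 * (\<integral>\<^sup>+\<omega>. ennreal ((Y \<omega> - Z \<omega>)\<^sup>2) \<partial>M)"
proof -
  have "(x - z)\<^sup>2 \<le> 2 * (x - y)\<^sup>2 + 2 * (y - z)\<^sup>2" for x y z :: real
    using zero_le_power2[of "(x - y) - (y - z)"] by (simp add: power2_eq_square algebra_simps)
  then have "ennreal ((x - z)\<^sup>2) \<le> 2 * ennreal ((x - y)\<^sup>2) + 2 * ennreal ((y - z)\<^sup>2)" for x y z :: real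
    by (subst (1 2) ennreal_numeral[symmetric]) (simp add: ennreal_mult'[symmetric] ennreal_plus[symmetric]
        ennreal_leI del: ennreal_plus ennreal_numeral)
  then have "(\<integral>\<^sup>+\<omega>. ennreal ((X \<omega> - Z \<omega>)\<^sup>2) \<partial>M)
    \<le> (\<integral>\<^sup>+\<omega>. 2 * ennreal ((X \<omega> - Y \<omega>)\<^sup>2) + 2 * ennreal ((Y \<omega> - Z \<omega>)\<^sup>2) \<partial>M)"
    by (intro nn_integral_mono)
  then show ?thesis
    by (simp add: nn_integral_add nn_integral_cmult)
qed

lemma tendsto_ennreal_sandwich_0:
  fixes f g :: "nat \<Rightarrow> ennreal"
  assumes "g \<longlonglongrightarrow> 0" "\<And>m. f m \<le> g m"
  shows "f \<longlonglongrightarrow> 0"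
  using tendsto_sandwich[of "\<lambda>_. 0" f sequentially g 0] assms by simp

lemma tendsto_L2_if_difference_vanishes:
  assumes [measurable]: "\<And>m. X m \<in> borel_measurable M" "\<And>m. Y m \<in> borel_measurable M"
    "Z \<in> borel_measurable M"
  assumes YX: "(\<lambda>m. \<integral>\<^sup>+\<omega>. ennreal ((Y m \<omega> - X m \<omega>)\<^sup>2) \<partial>M) \<longlonglongrightarrow> 0" and XZ: "tendsto_L2 M X Z"
  shows "tendsto_L2 M Y Z"
  unfolding tendsto_L2_def
proof (rule tendsto_ennreal_sandwich_0)
  show "(\<integral>\<^sup>+\<omega>. ennreal ((Y m \<omega> - Z \<omega>)\<^sup>2) \<partial>M)
    \<le> 2 * (\<integral>\<^sup>+\<omega>. ennreal ((Y m \<omega> - X m \<omega>)\<^sup>2) \<partial>M) + 2 * (\<integral>\<^sup>+\<omega>. ennreal ((X m \<omega> - Z \<omega>)\<^sup>2) \<partial>M)" for m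
    by (rule nn_integral_square_triangle) auto
  have "(\<lambda>m. 2 * (\<integral>\<^sup>+\<omega>. ennreal ((Y m \<omega> - X m \<omega>)\<^sup>2) \<partial>M) + 2 * (\<integral>\<^sup>+\<omega>. ennreal ((X m \<omega> - Z \<omega>)\<^sup>2) \<partial>M))
      \<longlonglongrightarrow> 2 * 0 + 2 * 0"
    using XZ unfolding tendsto_L2_def by (intro tendsto_add ennreal_tendsto_cmult YX) auto
  then show "(\<lambda>m. 2 * (\<integral>\<^sup>+\<omega>. ennreal ((Y m \<omega> - X m \<omega>)\<^sup>2) \<partial>M) + 2 * (\<integral>\<^sup>+\<omega>. ennreal ((X m \<omega> - Z \<omega>)\<^sup>2) \<partial>M))
      \<longlonglongrightarrow> 0" by simp
qed

lemma tendsto_L2_square_integrable: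
  assumes X: "\<And>m. square_integrable M (X m)" and [measurable]: "Z \<in> borel_measurable M"
    and XZ: "tendsto_L2 M X Z"
  shows "square_integrable M Z"
proof (rule square_integrableI_nn_integral)
  note [measurable] = square_integrable_measurable[OF X]
  have "\<forall>\<^sub>F m in sequentially. (\<integral>\<^sup>+\<omega>. ennreal ((X m \<omega> - Z \<omega>)\<^sup>2) \<partial>M) < 1"
    using XZ unfolding tendsto_L2_def by (rule order_tendstoD) simp
  then obtain m where m: "(\<integral>\<^sup>+\<omega>. ennreal ((X m \<omega> - Z \<omega>)\<^sup>2) \<partial>M) < 1"
    by (auto simp: eventually_sequentially)
  have "(\<integral>\<^sup>+\<omega>. ennreal ((0 - Z \<omega>)\<^sup>2) \<partial>M)
     \<le> 2 * (\<integral>\<^sup>+\<omega>. ennreal ((0 - X m \<omega>)\<^sup>2) \<partial>M) + 2 * (\<integral>\<^sup>+\<omega>. ennreal ((X m \<omega> - Z \<omega>)\<^sup>2) \<partial>M)"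
    by (rule nn_integral_square_triangle) auto
  also have "\<dots> < \<infinity>"
  proof -
    have "(\<integral>\<^sup>+\<omega>. ennreal ((X m \<omega> - Z \<omega>)\<^sup>2) \<partial>M) < \<top>"
      using m by (rule less_trans) simp
    then show ?thesis
      using nn_integral_eq_square_integrable[OF X[of m]] by (simp add: ennreal_mult_less_top)
  qed
  finally show "(\<integral>\<^sup>+\<omega>. ennreal ((Z \<omega>)\<^sup>2) \<partial>M) < \<infinity>" by simp
qed simp

lemma tendsto_L2_iff_integral:
  assumes "\<And>m. square_integrable M (X m)" "square_integrable M Z"
  shows "tendsto_L2 M X Z \<longleftrightarrow> (\<lambda>m. \<integral>\<omega>. (X m \<omega> - Z \<omega>)\<^sup>2 \<partial>M) \<longlonglongrightarrow> 0"
proof -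
  have "(\<lambda>m. ennreal (\<integral>\<omega>. (X m \<omega> - Z \<omega>)\<^sup>2 \<partial>M)) \<longlonglongrightarrow> ennreal 0
    \<longleftrightarrow> (\<lambda>m. \<integral>\<omega>. (X m \<omega> - Z \<omega>)\<^sup>2 \<partial>M) \<longlonglongrightarrow> 0"
    by (rule tendsto_ennreal_iff) auto
  then show ?thesis
    using nn_integral_eq_square_integrable[OF square_integrable_diff[OF assms]]
    by (simp add: tendsto_L2_def)
qed

text \<open>With \<open>x\<^sub>m = X\<^sub>m - x\<close> and \<open>y\<^sub>m = Y\<^sub>m - y\<close>, the difference of the two expectations is that of
  \<open>x\<^sub>m y\<^sub>m + x y\<^sub>m + x\<^sub>m y\<close>, and Cauchy-Schwarz makes each of the three terms small.\<close>

lemma tendsto_L2_inner: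
  assumes X: "\<And>m. square_integrable M (X m)" and Y: "\<And>m. square_integrable M (Y m)"
    and x: "square_integrable M x" and y: "square_integrable M y"
    and Xx: "tendsto_L2 M X x" and Yy: "tendsto_L2 M Y y"
  shows "(\<lambda>m. \<integral>\<omega>. X m \<omega> * Y m \<omega> \<partial>M) \<longlonglongrightarrow> (\<integral>\<omega>. x \<omega> * y \<omega> \<partial>M)"
proof -
  define a where "a m = (\<integral>\<omega>. (X m \<omega> - x \<omega>)\<^sup>2 \<partial>M)" for m
  define b where "b m = (\<integral>\<omega>. (Y m \<omega> - y \<omega>)\<^sup>2 \<partial>M)" for m
  have a: "a \<longlonglongrightarrow> 0" and b: "b \<longlonglongrightarrow> 0"
    using Xx Yy X Y x y by (simp_all add: tendsto_L2_iff_integral a_def[abs_def] b_def[abs_def])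
  have dX: "square_integrable M (\<lambda>\<omega>. X m \<omega> - x \<omega>)" and dY: "square_integrable M (\<lambda>\<omega>. Y m \<omega> - y \<omega>)" for m
    using X Y x y by (auto intro: square_integrable_diff)
  let ?c = "\<lambda>m. sqrt (a m * b m) + sqrt ((\<integral>\<omega>. (x \<omega>)\<^sup>2 \<partial>M) * b m) + sqrt (a m * (\<integral>\<omega>. (y \<omega>)\<^sup>2 \<partial>M))"
  have bound: "\<bar>(\<integral>\<omega>. X m \<omega> * Y m \<omega> \<partial>M) - (\<integral>\<omega>. x \<omega> * y \<omega> \<partial>M)\<bar> \<le> ?c m" for m
  proof -
    have "(\<integral>\<omega>. X m \<omega> * Y m \<omega> \<partial>M) = (\<integral>\<omega>. (X m \<omega> - x \<omega>) * (Y m \<omega> - y \<omega>) + x \<omega> * (Y m \<omega> - y \<omega>)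
        + (X m \<omega> - x \<omega>) * y \<omega> + x \<omega> * y \<omega> \<partial>M)"
      by (intro Bochner_Integration.integral_cong) (auto simp: algebra_simps)
    also have "\<dots> = (\<integral>\<omega>. (X m \<omega> - x \<omega>) * (Y m \<omega> - y \<omega>) \<partial>M) + (\<integral>\<omega>. x \<omega> * (Y m \<omega> - y \<omega>) \<partial>M)
        + (\<integral>\<omega>. (X m \<omega> - x \<omega>) * y \<omega> \<partial>M) + (\<integral>\<omega>. x \<omega> * y \<omega> \<partial>M)"
      using dX dY x y by (simp add: square_integrable_mult)
    finally show ?thesis
      using Cauchy_Schwarz_square_integrable[OF dX dY, of m m]
        Cauchy_Schwarz_square_integrable[OF x dY, of m]
        Cauchy_Schwarz_square_integrable[OF dX y, of m]
      unfolding a_def b_def by linarith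
  qed
  have "?c \<longlonglongrightarrow> sqrt (0 * 0) + sqrt ((\<integral>\<omega>. (x \<omega>)\<^sup>2 \<partial>M) * 0) + sqrt (0 * (\<integral>\<omega>. (y \<omega>)\<^sup>2 \<partial>M))"
    by (intro tendsto_intros a b)
  then have "?c \<longlonglongrightarrow> 0" by simp
  then have "(\<lambda>m. (\<integral>\<omega>. X m \<omega> * Y m \<omega> \<partial>M) - (\<integral>\<omega>. x \<omega> * y \<omega> \<partial>M)) \<longlonglongrightarrow> 0"
    by (rule Lim_null_comparison[rotated]) (use bound in \<open>auto simp: real_norm_def\<close>)
  then show ?thesis by (simp add: LIM_zero_iff)
qed

text \<open>Completeness of \<open>L\<^sup>2\<close> for sequences that are Cauchy at a geometric rate. The rate makes the
  increments absolutely summable in \<open>L\<^sup>1\<close>, hence almost surely, so the limit exists pointwise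
  without passing to a subsequence; Fatou's lemma then bounds the \<open>L\<^sup>2\<close>-distance to it.\<close>

lemma (in prob_space) L2_complete_geometric:
  fixes X :: "nat \<Rightarrow> 'a \<Rightarrow> real"
  assumes [measurable]: "\<And>m. X m \<in> borel_measurable M" and c: "0 \<le> c"
    and fast: "\<And>m k. m \<le> k \<Longrightarrow> (\<integral>\<^sup>+\<omega>. ennreal ((X m \<omega> - X k \<omega>)\<^sup>2) \<partial>M) \<le> ennreal (c / 4 ^ m)"
  obtains J where "J \<in> borel_measurable M" "tendsto_L2 M X J"
proof
  define J where "J \<omega> = lim (\<lambda>m. X m \<omega>)" for \<omega>
  show J [measurable]: "J \<in> borel_measurable M" unfolding J_def[abs_def] by measurable
  \<comment> \<open>The weight \<open>2 ^ m\<close> balances the two terms: against a second moment of order \<open>4 ^ -m\<close> both are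
    of the summable order \<open>2 ^ -m\<close>.\<close>
  have weighted: "\<bar>d\<bar> \<le> 2 ^ m * d\<^sup>2 + (1/2) ^ m" for d :: real and m :: nat
  proof -
    have "2 * (2 ^ m * \<bar>d\<bar>) \<le> (2 ^ m * \<bar>d\<bar>)\<^sup>2 + 1"
      using sum_squares_bound[of "2 ^ m * \<bar>d\<bar>" 1] by simp
    moreover have "0 \<le> 2 ^ m * \<bar>d\<bar>" by simp
    ultimately have "2 ^ m * \<bar>d\<bar> \<le> (2 ^ m * \<bar>d\<bar>)\<^sup>2 + 1" by linarith
    also have "\<dots> = 2 ^ m * (2 ^ m * d\<^sup>2 + (1/2) ^ m)"
      by (simp add: power_mult_distrib distrib_left power_one_over power2_eq_square[of "2 ^ m"] mult.assoc)
    finally show ?thesis by simp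
  qed
  have L1: "(\<integral>\<^sup>+\<omega>. ennreal \<bar>X (Suc m) \<omega> - X m \<omega>\<bar> \<partial>M) \<le> ennreal ((c + 1) * (1/2) ^ m)" for m
  proof -
    have "(\<integral>\<^sup>+\<omega>. ennreal \<bar>X (Suc m) \<omega> - X m \<omega>\<bar> \<partial>M)
        \<le> (\<integral>\<^sup>+\<omega>. ennreal (2 ^ m) * ennreal ((X m \<omega> - X (Suc m) \<omega>)\<^sup>2) + ennreal ((1/2) ^ m) \<partial>M)"
    proof (intro nn_integral_mono)
      fix \<omega>
      show "ennreal \<bar>X (Suc m) \<omega> - X m \<omega>\<bar>
          \<le> ennreal (2 ^ m) * ennreal ((X m \<omega> - X (Suc m) \<omega>)\<^sup>2) + ennreal ((1/2) ^ m)"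
        using weighted[of "X (Suc m) \<omega> - X m \<omega>" m]
        by (simp add: ennreal_mult[symmetric] ennreal_plus[symmetric] ennreal_leI power2_commute del: ennreal_plus)
    qed
    also have "\<dots> = ennreal (2 ^ m) * (\<integral>\<^sup>+\<omega>. ennreal ((X m \<omega> - X (Suc m) \<omega>)\<^sup>2) \<partial>M) + ennreal ((1/2) ^ m)"
      by (simp add: nn_integral_add nn_integral_cmult emeasure_space_1)
    also have "\<dots> \<le> ennreal (2 ^ m) * ennreal (c / 4 ^ m) + ennreal ((1/2) ^ m)"
      by (intro add_right_mono mult_left_mono fast) auto
    also have "\<dots> = ennreal (2 ^ m * (c / 4 ^ m) + (1/2) ^ m)"
      using c by (simp add: ennreal_mult[symmetric] ennreal_plus[symmetric] del: ennreal_plus)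
    also have "2 ^ m * (c / 4 ^ m) + (1/2) ^ m = (c + 1) * (1/2 :: real) ^ m"
      using power_mult_distrib[of "2::real" 2 m] by (simp add: field_simps)
    finally show ?thesis .
  qed
  have "(\<integral>\<^sup>+\<omega>. (\<Sum>m. ennreal \<bar>X (Suc m) \<omega> - X m \<omega>\<bar>) \<partial>M)
      = (\<Sum>m. \<integral>\<^sup>+\<omega>. ennreal \<bar>X (Suc m) \<omega> - X m \<omega>\<bar> \<partial>M)"
    by (rule nn_integral_suminf) auto
  also have "\<dots> \<le> (\<Sum>m. ennreal ((c + 1) * (1/2) ^ m))"
    by (intro suminf_le L1) auto
  also have "\<dots> < \<infinity>"
  proof -
    have "summable (\<lambda>m. (c + 1) * (1/2 :: real) ^ m)"
      by (intro summable_mult summable_geometric) simp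
    then show ?thesis using c by (subst suminf_ennreal2) simp_all
  qed
  finally have finite: "(\<integral>\<^sup>+\<omega>. (\<Sum>m. ennreal \<bar>X (Suc m) \<omega> - X m \<omega>\<bar>) \<partial>M) \<noteq> \<infinity>"
    by (rule less_imp_neq)
  have "AE \<omega> in M. (\<Sum>m. ennreal \<bar>X (Suc m) \<omega> - X m \<omega>\<bar>) \<noteq> \<infinity>"
    by (rule nn_integral_PInf_AE[OF _ finite]) measurable
  then have conv: "AE \<omega> in M. (\<lambda>m. X m \<omega>) \<longlonglongrightarrow> J \<omega>"
  proof eventually_elim
    fix \<omega> assume "(\<Sum>m. ennreal \<bar>X (Suc m) \<omega> - X m \<omega>\<bar>) \<noteq> \<infinity>"
    then have "summable (\<lambda>m. \<bar>X (Suc m) \<omega> - X m \<omega>\<bar>)"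
      by (intro summable_suminf_not_top) auto
    then have "summable (\<lambda>m. X (Suc m) \<omega> - X m \<omega>)"
      by (rule summable_rabs_cancel)
    then have "convergent (\<lambda>n. \<Sum>m<n. X (Suc m) \<omega> - X m \<omega>)"
      by (simp add: summable_iff_convergent)
    then have "convergent (\<lambda>n. (\<Sum>m<n. X (Suc m) \<omega> - X m \<omega>) + X 0 \<omega>)"
      by (intro convergent_add convergent_const)
    then have "convergent (\<lambda>n. X n \<omega>)" by (simp add: sum_lessThan_telescope[of "\<lambda>n. X n \<omega>"])
    then show "(\<lambda>m. X m \<omega>) \<longlonglongrightarrow> J \<omega>" by (simp add: J_def convergent_LIMSEQ_iff)
  qed
  have rate: "(\<integral>\<^sup>+\<omega>. ennreal ((X m \<omega> - J \<omega>)\<^sup>2) \<partial>M) \<le> ennreal (c / 4 ^ m)" for m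
  proof -
    have "(\<integral>\<^sup>+\<omega>. ennreal ((X m \<omega> - J \<omega>)\<^sup>2) \<partial>M)
        = (\<integral>\<^sup>+\<omega>. liminf (\<lambda>k. ennreal ((X m \<omega> - X k \<omega>)\<^sup>2)) \<partial>M)"
      using conv
    proof (intro nn_integral_cong_AE, eventually_elim)
      fix \<omega> assume "(\<lambda>m. X m \<omega>) \<longlonglongrightarrow> J \<omega>"
      then have "(\<lambda>k. ennreal ((X m \<omega> - X k \<omega>)\<^sup>2)) \<longlonglongrightarrow> ennreal ((X m \<omega> - J \<omega>)\<^sup>2)"
        by (intro tendsto_intros)
      then show "ennreal ((X m \<omega> - J \<omega>)\<^sup>2) = liminf (\<lambda>k. ennreal ((X m \<omega> - X k \<omega>)\<^sup>2))"
        by (rule lim_imp_Liminf[OF sequentially_bot, symmetric])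
    qed
    also have "\<dots> \<le> liminf (\<lambda>k. \<integral>\<^sup>+\<omega>. ennreal ((X m \<omega> - X k \<omega>)\<^sup>2) \<partial>M)"
      by (rule nn_integral_liminf) auto
    also have "\<dots> \<le> ennreal (c / 4 ^ m)"
    proof (rule order_trans[OF Liminf_le_Limsup])
      show "limsup (\<lambda>k. \<integral>\<^sup>+\<omega>. ennreal ((X m \<omega> - X k \<omega>)\<^sup>2) \<partial>M) \<le> ennreal (c / 4 ^ m)"
        using fast by (intro Limsup_bounded eventually_sequentiallyI[of m])
    qed simp
    finally show ?thesis .
  qed
  have "(\<lambda>m. ennreal (c / 4 ^ m)) \<longlonglongrightarrow> ennreal 0"
  proof (rule tendsto_ennrealI)
    have "(\<lambda>m. c * (1/4) ^ m) \<longlonglongrightarrow> c * 0"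
      by (intro tendsto_mult tendsto_const LIMSEQ_power_zero) simp
    then show "(\<lambda>m. c / 4 ^ m) \<longlonglongrightarrow> 0" by (simp add: power_one_over)
  qed
  then have "(\<lambda>m. ennreal (c / 4 ^ m)) \<longlonglongrightarrow> 0" unfolding ennreal_0 .
  then show "tendsto_L2 M X J"
    unfolding tendsto_L2_def using rate by (rule tendsto_ennreal_sandwich_0)
qed

section \<open>Increments of Brownian motion\<close>

lemma normal_rv_moments:
  assumes "prob_space M" and X: "normal_rv M 0 v X"
  shows "X \<in> borel_measurable M" "0 \<le> v" "integrable M (\<lambda>\<omega>. X \<omega> ^ k)"
    "(\<integral>\<omega>. X \<omega> \<partial>M) = 0" "(\<integral>\<omega>. (X \<omega>)\<^sup>2 \<partial>M) = v" "(\<integral>\<omega>. X \<omega> ^ 4 \<partial>M) = 3 * v\<^sup>2"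
proof -
  interpret prob_space M by fact
  show X_meas [measurable]: "X \<in> borel_measurable M"
    using X by (simp add: normal_rv_def)
  show v: "0 \<le> v" using X by (auto simp: normal_rv_def)
  consider (deg) "v = 0" "AE \<omega> in M. X \<omega> = 0"
    | (dens) "v > 0" "distributed M lborel X (\<lambda>x. ennreal (normal_density 0 (sqrt v) x))"
    using X by (auto simp: normal_rv_def)
  then have "integrable M (\<lambda>\<omega>. X \<omega> ^ k) \<and> (\<integral>\<omega>. X \<omega> \<partial>M) = 0 \<and> (\<integral>\<omega>. (X \<omega>)\<^sup>2 \<partial>M) = v
    \<and> (\<integral>\<omega>. X \<omega> ^ 4 \<partial>M) = 3 * v\<^sup>2"
  proof cases
    case deg
    have pow: "integrable M (\<lambda>\<omega>. X \<omega> ^ j) \<and> (\<integral>\<omega>. X \<omega> ^ j \<partial>M) = 0 ^ j" for j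
    proof -
      have ae: "AE \<omega> in M. X \<omega> ^ j = 0 ^ j" using deg(2) by auto
      have "integrable M (\<lambda>\<omega>. X \<omega> ^ j) \<longleftrightarrow> integrable M (\<lambda>\<omega>. (0::real) ^ j)"
        by (rule integrable_cong_AE) (use ae in auto)
      moreover have "(\<integral>\<omega>. X \<omega> ^ j \<partial>M) = (\<integral>\<omega>. (0::real) ^ j \<partial>M)"
        by (rule integral_cong_AE) (use ae in auto)
      ultimately show ?thesis by (simp add: prob_space)
    qed
    show ?thesis using pow[of k] pow[of 1] pow[of 2] pow[of 4] deg(1) by simp
  next
    case dens
    have s: "0 < sqrt v" using dens(1) by simp
    have I: "integrable M (\<lambda>\<omega>. X \<omega> ^ j)" for j
      using integrable_normal_moment[OF s, of 0 j] distributed_integrable[OF dens(2), of "\<lambda>x. x ^ j"] by simp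
    have E: "(\<integral>\<omega>. X \<omega> ^ j \<partial>M) = (\<integral>x. normal_density 0 (sqrt v) x * x ^ j \<partial>lborel)" for j
      using distributed_integral[OF dens(2), of "\<lambda>x. x ^ j"] by simp
    have "(\<integral>x. normal_density 0 (sqrt v) x * x ^ 2 \<partial>lborel) = v"
      using integral_normal_moment_even[OF s, of 0 1] dens(1) by (simp add: fact_numeral)
    moreover have "(\<integral>x. normal_density 0 (sqrt v) x * x ^ 4 \<partial>lborel) = 3 * v\<^sup>2"
      using integral_normal_moment_even[OF s, of 0 2] dens(1) by (simp add: fact_numeral power_divide)
    moreover have "(\<integral>x. normal_density 0 (sqrt v) x * x ^ 1 \<partial>lborel) = 0"
      using integral_normal_moment_odd[OF s, of 0 0] by simp
    ultimately show ?thesis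
      using I[of k] E[of 1] E[of 2] E[of 4] by simp
  qed
  then show "integrable M (\<lambda>\<omega>. X \<omega> ^ k)"
    "(\<integral>\<omega>. X \<omega> \<partial>M) = 0" "(\<integral>\<omega>. (X \<omega>)\<^sup>2 \<partial>M) = v" "(\<integral>\<omega>. X \<omega> ^ 4 \<partial>M) = 3 * v\<^sup>2" by auto
qed

locale brownian = prob_space M
  for M :: "'w measure" and \<Sigma> :: "real ^ 'n ^ 'n" and B :: "real \<Rightarrow> 'w \<Rightarrow> real ^ 'n" +
  assumes bm: "brownian_motion M \<Sigma> B"
begin

abbreviation "\<F> \<equiv> natural_filtration M B"

abbreviation incr :: "'n \<Rightarrow> real \<Rightarrow> real \<Rightarrow> 'w \<Rightarrow> real" where
  "incr q s t \<omega> \<equiv> B t \<omega> $ q - B s \<omega> $ q"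

lemma B_measurable: "0 \<le> t \<Longrightarrow> B t \<in> borel_measurable M"
  using bm by (simp add: brownian_motion_def)

lemma B_component_measurable [measurable (raw)]: "0 \<le> t \<Longrightarrow> (\<lambda>\<omega>. B t \<omega> $ q) \<in> borel_measurable M"
  using measurable_compose[OF B_measurable borel_measurable_nth] by simp

lemma B_0: "AE \<omega> in M. B 0 \<omega> = 0"
  using bm by (simp add: brownian_motion_def)

lemma paths_continuous: "AE \<omega> in M. continuous_on {0..} (\<lambda>t. B t \<omega>)"
  using bm by (simp add: brownian_motion_def)

lemma space_filtration [simp]: "space (\<F> t) = space M"
  by (simp add: natural_filtration_def space_measure_of_conv)

lemma sets_filtration:
  "sets (\<F> t) = sigma_sets (space M) (\<Union>s\<in>{0..t}. {B s -` A \<inter> space M |A. A \<in> sets borel})"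
  unfolding natural_filtration_def by (rule sets_measure_of) auto

lemma filtration_subset: "sets (\<F> t) \<subseteq> sets M"
  unfolding sets_filtration
  by (rule sets.sigma_sets_subset) (auto intro: measurable_sets[OF B_measurable])

lemma filtration_mono: "s \<le> t \<Longrightarrow> sets (\<F> s) \<subseteq> sets (\<F> t)"
  unfolding sets_filtration by (intro sigma_sets_mono' UN_mono) auto

lemma measurable_from_filtration: "X \<in> borel_measurable (\<F> t) \<Longrightarrow> X \<in> borel_measurable M"
  using filtration_subset by (auto simp: measurable_def)

lemma measurable_filtration_mono: "s \<le> t \<Longrightarrow> X \<in> borel_measurable (\<F> s) \<Longrightarrow> X \<in> borel_measurable (\<F> t)"
  using filtration_mono by (auto simp: measurable_def)

lemma B_adapted: "0 \<le> s \<Longrightarrow> s \<le> t \<Longrightarrow> B s \<in> borel_measurable (\<F> t)"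
  by (rule measurableI) (auto simp: sets_filtration intro!: sigma_sets.Basic UN_I[of s])

lemma B_component_adapted: "0 \<le> s \<Longrightarrow> s \<le> t \<Longrightarrow> (\<lambda>\<omega>. B s \<omega> $ q) \<in> borel_measurable (\<F> t)"
  using measurable_compose[OF B_adapted borel_measurable_nth] by simp

lemma multivariate_normal_incr:
  "0 \<le> s \<Longrightarrow> s \<le> t \<Longrightarrow> multivariate_normal M 0 ((t - s) *\<^sub>R \<Sigma>) (\<lambda>\<omega>. B t \<omega> - B s \<omega>)"
  using bm by (simp add: brownian_motion_def)

lemma Sigma_symmetric: "\<Sigma> $ p $ q = \<Sigma> $ q $ p"
proof -
  have "transpose \<Sigma> = \<Sigma>"
    using multivariate_normal_incr[of 0 1] by (simp add: multivariate_normal_def)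
  then have "transpose \<Sigma> $ p $ q = \<Sigma> $ p $ q" by simp
  then show ?thesis by (simp add: transpose_def)
qed

lemma normal_projection_incr:
  "0 \<le> s \<Longrightarrow> s \<le> t \<Longrightarrow>
    normal_rv M (u \<bullet> 0) (u \<bullet> (((t - s) *\<^sub>R \<Sigma>) *v u)) (\<lambda>\<omega>. u \<bullet> (B t \<omega> - B s \<omega>))"
  using multivariate_normal_incr by (simp add: multivariate_normal_def)

lemma normal_incr:
  assumes "0 \<le> s" "s \<le> t"
  shows "normal_rv M 0 ((t - s) * \<Sigma> $ q $ q) (incr q s t)"
proof -
  let ?u = "axis q 1 :: real ^ 'n"
  have "normal_rv M (?u \<bullet> 0) (?u \<bullet> (((t - s) *\<^sub>R \<Sigma>) *v ?u)) (\<lambda>\<omega>. ?u \<bullet> (B t \<omega> - B s \<omega>))"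
    using assms by (rule normal_projection_incr)
  then show ?thesis
    by (simp add: inner_axis' matrix_vector_mul_component inner_axis)
qed

lemma normal_incr_add:
  assumes "0 \<le> s" "s \<le> t"
  shows "normal_rv M 0 ((t - s) * (\<Sigma> $ p $ p + \<Sigma> $ q $ q + 2 * \<Sigma> $ p $ q)) (\<lambda>\<omega>. incr p s t \<omega> + incr q s t \<omega>)"
proof -
  let ?u = "axis p 1 + axis q 1 :: real ^ 'n"
  have "normal_rv M (?u \<bullet> 0) (?u \<bullet> (((t - s) *\<^sub>R \<Sigma>) *v ?u)) (\<lambda>\<omega>. ?u \<bullet> (B t \<omega> - B s \<omega>))"
    using assms by (rule normal_projection_incr)
  moreover have "?u \<bullet> (((t - s) *\<^sub>R \<Sigma>) *v ?u) = (t - s) * (\<Sigma> $ p $ p + \<Sigma> $ q $ q + 2 * \<Sigma> $ p $ q)"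
    by (simp add: inner_add_left inner_axis' matrix_vector_mul_component inner_axis inner_add_right
        Sigma_symmetric[of q p] algebra_simps)
  ultimately show ?thesis
    by (simp add: inner_add_left inner_axis')
qed

lemma incr_measurable: "0 \<le> s \<Longrightarrow> s \<le> t \<Longrightarrow> incr q s t \<in> borel_measurable M"
  by measurable

lemma square_integrable_incr: "0 \<le> s \<Longrightarrow> s \<le> t \<Longrightarrow> square_integrable M (incr q s t)"
  using normal_rv_moments(1,3)[OF prob_space_axioms normal_incr, of s t q]
  by (simp add: square_integrable_def)

lemma expectation_incr: "0 \<le> s \<Longrightarrow> s \<le> t \<Longrightarrow> expectation (incr q s t) = 0"
  using normal_rv_moments(4)[OF prob_space_axioms normal_incr] by simp

lemma Sigma_diag_nonneg: "0 \<le> \<Sigma> $ q $ q"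
  using normal_rv_moments(2)[OF prob_space_axioms normal_incr[of 0 1 q]] by simp

text \<open>Only linear functionals of an increment are known to be normal, so mixed moments come from
  polarization: \<open>2 x y = (x + y)\<^sup>2 - x\<^sup>2 - y\<^sup>2\<close>.\<close>

lemma covariance_incr:
  assumes st: "0 \<le> s" "s \<le> t"
  shows "expectation (\<lambda>\<omega>. incr p s t \<omega> * incr q s t \<omega>) = (t - s) * \<Sigma> $ p $ q"
proof -
  note D = square_integrable_incr[OF st]
  have sq: "expectation (\<lambda>\<omega>. (incr r s t \<omega>)\<^sup>2) = (t - s) * \<Sigma> $ r $ r" for r
    using normal_rv_moments(5)[OF prob_space_axioms normal_incr[OF st]] by simp
  have "(t - s) * (\<Sigma> $ p $ p + \<Sigma> $ q $ q + 2 * \<Sigma> $ p $ q)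
      = expectation (\<lambda>\<omega>. (incr p s t \<omega> + incr q s t \<omega>)\<^sup>2)"
    using normal_rv_moments(5)[OF prob_space_axioms normal_incr_add[OF st]] by simp
  also have "\<dots> = expectation (\<lambda>\<omega>. (incr p s t \<omega>)\<^sup>2 + (incr q s t \<omega>)\<^sup>2 + 2 * (incr p s t \<omega> * incr q s t \<omega>))"
    by (intro Bochner_Integration.integral_cong) (simp_all add: power2_eq_square algebra_simps)
  also have "\<dots> = (t - s) * \<Sigma> $ p $ p + (t - s) * \<Sigma> $ q $ q + 2 * expectation (\<lambda>\<omega>. incr p s t \<omega> * incr q s t \<omega>)"
    using D[of p] D[of q] square_integrable_mult[OF D[of p] D[of q]]
    by (simp add: square_integrable_def sq del: power2_diff)
  finally show ?thesis by (simp add: algebra_simps)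
qed

text \<open>A bound by fourth moments of the single components, through
  \<open>2 (x y)\<^sup>2 \<le> x\<^sup>4 + y\<^sup>4\<close>. Its quadratic dependence on \<open>t - s\<close> is what makes the quadratic
  covariation deterministic.\<close>

lemma square_integrable_incr_mult:
  assumes st: "0 \<le> s" "s \<le> t"
  shows "square_integrable M (\<lambda>\<omega>. incr p s t \<omega> * incr q s t \<omega>)"
    and "expectation (\<lambda>\<omega>. (incr p s t \<omega> * incr q s t \<omega>)\<^sup>2)
       \<le> 3 / 2 * (t - s)\<^sup>2 * ((\<Sigma> $ p $ p)\<^sup>2 + (\<Sigma> $ q $ q)\<^sup>2)"
proof -
  have [measurable]: "incr r s t \<in> borel_measurable M" for r
    using st by (rule incr_measurable)
  have i4: "integrable M (\<lambda>\<omega>. incr r s t \<omega> ^ 4)" for r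
    by (rule normal_rv_moments(3)[OF prob_space_axioms normal_incr[OF st]])
  have e4: "expectation (\<lambda>\<omega>. incr r s t \<omega> ^ 4) = 3 * ((t - s) * \<Sigma> $ r $ r)\<^sup>2" for r
    by (rule normal_rv_moments(6)[OF prob_space_axioms normal_incr[OF st]])
  have le: "(x * y)\<^sup>2 \<le> 1 / 2 * x ^ 4 + 1 / 2 * y ^ 4" for x y :: real
    using sum_squares_bound[of "x\<^sup>2" "y\<^sup>2"] by (simp add: power_mult_distrib field_simps)
  have i: "integrable M (\<lambda>\<omega>. 1 / 2 * incr p s t \<omega> ^ 4 + 1 / 2 * incr q s t \<omega> ^ 4)"
    using i4 by (intro Bochner_Integration.integrable_add integrable_mult_right) auto
  have int: "integrable M (\<lambda>\<omega>. (incr p s t \<omega> * incr q s t \<omega>)\<^sup>2)"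
    by (rule Bochner_Integration.integrable_bound[OF i]) (auto intro!: order_trans[OF le])
  then show "square_integrable M (\<lambda>\<omega>. incr p s t \<omega> * incr q s t \<omega>)"
    by (simp add: square_integrable_def)
  have "expectation (\<lambda>\<omega>. (incr p s t \<omega> * incr q s t \<omega>)\<^sup>2)
    \<le> expectation (\<lambda>\<omega>. 1 / 2 * incr p s t \<omega> ^ 4 + 1 / 2 * incr q s t \<omega> ^ 4)"
    by (rule integral_mono[OF int i]) (rule le)
  also have "\<dots> = 3 / 2 * (t - s)\<^sup>2 * ((\<Sigma> $ p $ p)\<^sup>2 + (\<Sigma> $ q $ q)\<^sup>2)"
    using i4[of p] i4[of q] by (simp add: e4 power_mult_distrib distrib_left)
  finally show "expectation (\<lambda>\<omega>. (incr p s t \<omega> * incr q s t \<omega>)\<^sup>2)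
       \<le> 3 / 2 * (t - s)\<^sup>2 * ((\<Sigma> $ p $ p)\<^sup>2 + (\<Sigma> $ q $ q)\<^sup>2)" .
qed

text \<open>The form in which independence of increments is used throughout: a factor known at time \<open>s\<close>
  splits off from any function of the increment over \<open>[s, t]\<close>.\<close>

lemma indep_past_incr:
  fixes g :: "real ^ 'n \<Rightarrow> real"
  assumes st: "0 \<le> s" "s \<le> t" and X: "X \<in> borel_measurable (\<F> s)" "integrable M X"
    and g: "g \<in> borel_measurable borel" "integrable M (\<lambda>\<omega>. g (B t \<omega> - B s \<omega>))"
  shows "integrable M (\<lambda>\<omega>. X \<omega> * g (B t \<omega> - B s \<omega>))"
    and "expectation (\<lambda>\<omega>. X \<omega> * g (B t \<omega> - B s \<omega>)) = expectation X * expectation (\<lambda>\<omega>. g (B t \<omega> - B s \<omega>))"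
proof -
  let ?D = "\<lambda>\<omega>. B t \<omega> - B s \<omega>"
  have D [measurable]: "?D \<in> borel_measurable M"
    using st by (intro borel_measurable_diff B_measurable) auto
  have ind: "indep_set (sets (\<F> s)) (sets (vimage_algebra (space M) ?D borel))"
    using bm st by (simp add: brownian_motion_def)
  have "indep_var borel X borel (\<lambda>\<omega>. g (?D \<omega>))"
    unfolding indep_var_eq
  proof (intro conjI)
    show "random_variable borel X" "random_variable borel (\<lambda>\<omega>. g (?D \<omega>))"
      using X(2) g(2) by auto
    have "sigma_sets (space M) {X -` A \<inter> space M |A. A \<in> sets borel} \<subseteq> sets (\<F> s)"
      by (rule sets.sigma_sets_subset[of _ "\<F> s", unfolded space_filtration])
        (use measurable_sets[OF X(1)] in auto)
    moreover have "sigma_sets (space M) {(\<lambda>\<omega>. g (?D \<omega>)) -` A \<inter> space M |A. A \<in> sets borel}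
        \<subseteq> sets (vimage_algebra (space M) ?D borel)"
    proof -
      have "(\<lambda>\<omega>. g (?D \<omega>)) \<in> borel_measurable (vimage_algebra (space M) ?D borel)"
        by (rule measurable_compose[OF measurable_vimage_algebra1 g(1)]) auto
      then show ?thesis
        by (intro sets.sigma_sets_subset[of _ "vimage_algebra (space M) ?D borel", unfolded space_vimage_algebra])
          (auto dest: measurable_sets)
    qed
    ultimately show "indep_set (sigma_sets (space M) {X -` A \<inter> space M |A. A \<in> sets borel})
       (sigma_sets (space M) {(\<lambda>\<omega>. g (?D \<omega>)) -` A \<inter> space M |A. A \<in> sets borel})"
      using ind unfolding indep_set_def by (elim indep_sets_mono_sets) (auto split: bool.splits)
  qed
  then show "integrable M (\<lambda>\<omega>. X \<omega> * g (?D \<omega>))"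
    "expectation (\<lambda>\<omega>. X \<omega> * g (?D \<omega>)) = expectation X * expectation (\<lambda>\<omega>. g (?D \<omega>))"
    using X(2) g(2) by (auto intro: indep_var_integrable indep_var_lebesgue_integral)
qed

lemma square_integrable_past_mult_incr:
  assumes st: "0 \<le> s" "s \<le> t" and X: "X \<in> borel_measurable (\<F> s)" "square_integrable M X"
  shows "square_integrable M (\<lambda>\<omega>. X \<omega> * incr q s t \<omega>)"
proof -
  note [measurable] = X(1) square_integrable_measurable[OF X(2)] incr_measurable[OF st]
  have "integrable M (\<lambda>\<omega>. (X \<omega>)\<^sup>2 * (\<lambda>x. (x $ q)\<^sup>2) (B t \<omega> - B s \<omega>))"
    by (rule indep_past_incr(1)[OF st])
      (use X square_integrable_incr[OF st, of q] in \<open>auto simp: square_integrable_def\<close>)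
  then show ?thesis
    by (simp add: square_integrable_def power_mult_distrib)
qed

text \<open>The earlier increment, together with both coefficients, is known when the later increment
  starts, and the later increment has mean zero.\<close>

lemma expectation_disjoint_increments:
  assumes t: "0 \<le> a" "a \<le> b" "b \<le> c" "c \<le> d"
    and X: "X \<in> borel_measurable (\<F> a)" "square_integrable M X"
    and Y: "Y \<in> borel_measurable (\<F> c)" "square_integrable M Y"
  shows "expectation (\<lambda>\<omega>. (X \<omega> * incr p a b \<omega>) * (Y \<omega> * incr q c d \<omega>)) = 0"
proof -
  have c: "0 \<le> c" using t by simp
  have [measurable]: "X \<in> borel_measurable (\<F> c)" "Y \<in> borel_measurable (\<F> c)"
    "(\<lambda>\<omega>. B a \<omega> $ p) \<in> borel_measurable (\<F> c)" "(\<lambda>\<omega>. B b \<omega> $ p) \<in> borel_measurable (\<F> c)"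
    using X Y t by (auto intro: measurable_filtration_mono[of a c] B_component_adapted)
  have "expectation (\<lambda>\<omega>. (X \<omega> * incr p a b \<omega> * Y \<omega>) * (\<lambda>x. x $ q) (B d \<omega> - B c \<omega>))
     = expectation (\<lambda>\<omega>. X \<omega> * incr p a b \<omega> * Y \<omega>) * expectation (\<lambda>\<omega>. (\<lambda>x. x $ q) (B d \<omega> - B c \<omega>))"
  proof (rule indep_past_incr(2)[OF c t(4)])
    show "integrable M (\<lambda>\<omega>. X \<omega> * incr p a b \<omega> * Y \<omega>)"
      using t X Y by (intro square_integrable_mult square_integrable_past_mult_incr) auto
    show "integrable M (\<lambda>\<omega>. (B d \<omega> - B c \<omega>) $ q)"
      using integrable_if_square_integrable[OF square_integrable_incr[OF c t(4), of q]] by simp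
  qed auto
  then show ?thesis
    using expectation_incr[OF c t(4), of q] by (simp add: mult_ac)
qed

lemma expectation_same_increment:
  assumes t: "0 \<le> a" "a \<le> b"
    and X: "X \<in> borel_measurable (\<F> a)" "square_integrable M X"
    and Y: "Y \<in> borel_measurable (\<F> a)" "square_integrable M Y"
  shows "expectation (\<lambda>\<omega>. (X \<omega> * incr q a b \<omega>) * (Y \<omega> * incr q a b \<omega>))
    = \<Sigma> $ q $ q * expectation (\<lambda>\<omega>. X \<omega> * Y \<omega>) * (b - a)"
proof -
  have "expectation (\<lambda>\<omega>. (X \<omega> * Y \<omega>) * (\<lambda>x. x $ q * x $ q) (B b \<omega> - B a \<omega>))
     = expectation (\<lambda>\<omega>. X \<omega> * Y \<omega>) * expectation (\<lambda>\<omega>. (\<lambda>x. x $ q * x $ q) (B b \<omega> - B a \<omega>))"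
    by (rule indep_past_incr(2)[OF t]) (use X Y in \<open>auto intro: square_integrable_mult
          square_integrable_mult[OF square_integrable_incr[OF t] square_integrable_incr[OF t]]\<close>)
  then show ?thesis
    using covariance_incr[OF t, of q q] by (simp add: mult_ac)
qed

end

section \<open>The isometry for families of steps\<close>

text \<open>Simple processes in a form closed under subtraction: a finite family of steps, with value
  \<open>\<xi> k\<close> on \<open>(a k, b k]\<close>, whose intervals may overlap arbitrarily. The difference of two simple
  processes over different partitions is then the disjoint union of the two families, so the
  isometry gives the distance of their integrals at once.\<close>

definition step_value :: "'k set \<Rightarrow> ('k \<Rightarrow> 'w \<Rightarrow> real) \<Rightarrow> ('k \<Rightarrow> real) \<Rightarrow> ('k \<Rightarrow> real) \<Rightarrow> 'w \<times> real \<Rightarrow> real" where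
  "step_value A \<xi> a b = (\<lambda>(\<omega>, s). \<Sum>k\<in>A. \<xi> k \<omega> * indicator {a k<..b k} s)"

definition step_integral ::
  "'k set \<Rightarrow> ('k \<Rightarrow> 'w \<Rightarrow> real) \<Rightarrow> ('k \<Rightarrow> real) \<Rightarrow> ('k \<Rightarrow> real) \<Rightarrow> (real \<Rightarrow> 'w \<Rightarrow> real) \<Rightarrow> 'w \<Rightarrow> real" where
  "step_integral A \<xi> a b W \<omega> = (\<Sum>k\<in>A. \<xi> k \<omega> * (W (b k) \<omega> - W (a k) \<omega>))"

lemma finite_measure_interval: "finite_measure (restrict_space lborel {0..T::real})"
  by (rule finite_measureI) (simp add: emeasure_restrict_space space_restrict_space emeasure_lborel_Icc_eq)

context brownian
begin

text \<open>If \<open>a \<le> c\<close>, cutting both intervals at \<open>c\<close> and at the smaller right end leaves products of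
  increments over disjoint intervals, which vanish, and one product over the intersection.
  Every cut point is at least as large as the time where the respective coefficient is known.\<close>

lemma expectation_increment_pair_ordered:
  assumes t: "0 \<le> a" "a \<le> b" "a \<le> c" "c \<le> d"
    and X: "X \<in> borel_measurable (\<F> a)" "square_integrable M X"
    and Y: "Y \<in> borel_measurable (\<F> c)" "square_integrable M Y"
  shows "expectation (\<lambda>\<omega>. (X \<omega> * incr q a b \<omega>) * (Y \<omega> * incr q c d \<omega>))
    = \<Sigma> $ q $ q * expectation (\<lambda>\<omega>. X \<omega> * Y \<omega>) * measure lborel ({a<..b} \<inter> {c<..d})"
proof -
  define E where "E s t u v = expectation (\<lambda>\<omega>. (X \<omega> * incr q s t \<omega>) * (Y \<omega> * incr q u v \<omega>))" for s t u v
  have X': "X \<in> borel_measurable (\<F> s)" if "a \<le> s" for s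
    using measurable_filtration_mono[OF that X(1)] .
  have Y': "Y \<in> borel_measurable (\<F> s)" if "c \<le> s" for s
    using measurable_filtration_mono[OF that Y(1)] .
  have int: "integrable M (\<lambda>\<omega>. (X \<omega> * incr q s t \<omega>) * (Y \<omega> * incr q u v \<omega>))"
    if "a \<le> s" "s \<le> t" "c \<le> u" "u \<le> v" for s t u v
    using that t X' Y' X(2) Y(2) by (intro square_integrable_mult square_integrable_past_mult_incr) auto
  have left: "E s t u v = E s r u v + E r t u v" if "a \<le> s" "s \<le> r" "r \<le> t" "c \<le> u" "u \<le> v" for s r t u v
  proof -
    have "E s t u v = expectation (\<lambda>\<omega>. (X \<omega> * incr q s r \<omega>) * (Y \<omega> * incr q u v \<omega>)
        + (X \<omega> * incr q r t \<omega>) * (Y \<omega> * incr q u v \<omega>))"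
      unfolding E_def by (intro Bochner_Integration.integral_cong) (simp_all add: algebra_simps)
    also have "\<dots> = E s r u v + E r t u v"
      unfolding E_def using that by (intro Bochner_Integration.integral_add int) auto
    finally show ?thesis .
  qed
  have right: "E s t u v = E s t u r + E s t r v" if "a \<le> s" "s \<le> t" "c \<le> u" "u \<le> r" "r \<le> v" for s t u r v
  proof -
    have "E s t u v = expectation (\<lambda>\<omega>. (X \<omega> * incr q s t \<omega>) * (Y \<omega> * incr q u r \<omega>)
        + (X \<omega> * incr q s t \<omega>) * (Y \<omega> * incr q r v \<omega>))"
      unfolding E_def by (intro Bochner_Integration.integral_cong) (simp_all add: algebra_simps)
    also have "\<dots> = E s t u r + E s t r v"
      unfolding E_def using that by (intro Bochner_Integration.integral_add int) auto
    finally show ?thesis .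
  qed
  have before: "E s t u v = 0" if "a \<le> s" "s \<le> t" "t \<le> u" "c \<le> u" "u \<le> v" for s t u v
    unfolding E_def using that t X X' Y Y' by (intro expectation_disjoint_increments) auto
  have after: "E s t u v = 0" if "a \<le> s" "v \<le> s" "s \<le> t" "c \<le> u" "u \<le> v" for s t u v
    unfolding E_def
    by (subst mult.commute) (use that t X X' Y Y' in \<open>intro expectation_disjoint_increments; auto\<close>)
  have same: "E c t c t = \<Sigma> $ q $ q * expectation (\<lambda>\<omega>. X \<omega> * Y \<omega>) * (t - c)" if "c \<le> t" for t
    unfolding E_def using that t X(2) X'[of c] Y by (intro expectation_same_increment) auto
  consider "b \<le> c" | "c \<le> b" "b \<le> d" | "c \<le> b" "d \<le> b" by linarith
  then have "E a b c d = \<Sigma> $ q $ q * expectation (\<lambda>\<omega>. X \<omega> * Y \<omega>) * measure lborel ({a<..b} \<inter> {c<..d})"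
  proof cases
    case 1
    then have "{a<..b} \<inter> {c<..d} = {}" by auto
    then show ?thesis using before[of a b c d] 1 t by simp
  next
    case 2
    have "{a<..b} \<inter> {c<..d} = {c<..b}" using 2 t by auto
    moreover have "E a b c d = E a c c d + (E c b c b + E c b b d)"
      using left[of a c b c d] right[of c b c b d] 2 t by simp
    ultimately show ?thesis
      using before[of a c c d] before[of c b b d] same[of b] 2 t by simp
  next
    case 3
    have "{a<..b} \<inter> {c<..d} = {c<..d}" using 3 t by auto
    moreover have "E a b c d = E a c c d + (E c d c d + E d b c d)"
      using left[of a c b c d] left[of c d b c d] 3 t by simp
    ultimately show ?thesis
      using before[of a c c d] after[of d d b c] same[of d] 3 t by simp
  qed
  then show ?thesis by (simp add: E_def)
qed

lemma expectation_increment_pair: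
  assumes t: "0 \<le> a" "a \<le> b" "0 \<le> c" "c \<le> d"
    and X: "X \<in> borel_measurable (\<F> a)" "square_integrable M X"
    and Y: "Y \<in> borel_measurable (\<F> c)" "square_integrable M Y"
  shows "expectation (\<lambda>\<omega>. (X \<omega> * incr q a b \<omega>) * (Y \<omega> * incr q c d \<omega>))
    = \<Sigma> $ q $ q * expectation (\<lambda>\<omega>. X \<omega> * Y \<omega>) * measure lborel ({a<..b} \<inter> {c<..d})"
proof (cases "a \<le> c")
  case True
  then show ?thesis using t X Y by (intro expectation_increment_pair_ordered)
next
  case False
  then have "expectation (\<lambda>\<omega>. (Y \<omega> * incr q c d \<omega>) * (X \<omega> * incr q a b \<omega>))
    = \<Sigma> $ q $ q * expectation (\<lambda>\<omega>. Y \<omega> * X \<omega>) * measure lborel ({c<..d} \<inter> {a<..b})"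
    using t X Y by (intro expectation_increment_pair_ordered) auto
  then show ?thesis by (simp add: mult.commute Int_commute)
qed

definition adapted_steps ::
  "real \<Rightarrow> 'k set \<Rightarrow> ('k \<Rightarrow> 'w \<Rightarrow> real) \<Rightarrow> ('k \<Rightarrow> real) \<Rightarrow> ('k \<Rightarrow> real) \<Rightarrow> bool" where
  "adapted_steps T A \<xi> a b \<longleftrightarrow> finite A \<and> (\<forall>k\<in>A. 0 \<le> a k \<and> a k \<le> b k \<and> b k \<le> T \<and>
     \<xi> k \<in> borel_measurable (\<F> (a k)) \<and> square_integrable M (\<xi> k))"

lemma square_integrable_step_integral:
  assumes "adapted_steps T A \<xi> a b"
  shows "square_integrable M (step_integral A \<xi> a b (\<lambda>s \<omega>. B s \<omega> $ q))"
  unfolding step_integral_def[abs_def]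
  using assms by (intro square_integrable_sum square_integrable_past_mult_incr) (auto simp: adapted_steps_def)

lemma step_value_measurable:
  assumes "adapted_steps T A \<xi> a b"
  shows "step_value A \<xi> a b \<in> borel_measurable (M \<Otimes>\<^sub>M restrict_space lborel {0..T})"
  unfolding step_value_def case_prod_unfold
proof (intro borel_measurable_sum borel_measurable_times)
  fix k assume "k \<in> A"
  then have "\<xi> k \<in> borel_measurable M"
    using assms by (auto simp: adapted_steps_def square_integrable_measurable)
  then show "(\<lambda>p. \<xi> k (fst p)) \<in> borel_measurable (M \<Otimes>\<^sub>M restrict_space lborel {0..T})"
    by (rule measurable_compose[OF measurable_fst])
  have "(\<lambda>s. indicator {a k<..b k} s :: real) \<in> borel_measurable (restrict_space lborel {0..T})"
    by (rule measurable_restrict_space1) measurable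
  then show "(\<lambda>p. indicator {a k<..b k} (snd p) :: real) \<in> borel_measurable (M \<Otimes>\<^sub>M restrict_space lborel {0..T})"
    by (rule measurable_compose[OF measurable_snd])
qed

lemma nn_integral_path_measure:
  assumes "f \<in> borel_measurable (M \<Otimes>\<^sub>M restrict_space lborel {0..T})"
  shows "(\<integral>\<^sup>+p. f p \<partial>path_measure M T) = (\<integral>\<^sup>+s. \<integral>\<^sup>+\<omega>. f (\<omega>, s) \<partial>M \<partial>restrict_space lborel {0..T})"
proof -
  interpret L: finite_measure "restrict_space lborel {0..T}" by (rule finite_measure_interval)
  interpret pair_sigma_finite M "restrict_space lborel {0..T}" ..
  show ?thesis
    unfolding path_measure_def nn_integral_completion using nn_integral_snd[OF assms] by simp
qed

text \<open>Both sides are bilinear in the family of steps: expanding the squares turns them into double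
  sums over pairs of steps, which agree pair by pair by \<open>expectation_increment_pair\<close>.\<close>

lemma Ito_isometry:
  assumes steps: "adapted_steps T A \<xi> a b"
  shows "(\<integral>\<^sup>+\<omega>. ennreal ((step_integral A \<xi> a b (\<lambda>s \<omega>. B s \<omega> $ q) \<omega>)\<^sup>2) \<partial>M)
    = ennreal (\<Sigma> $ q $ q) * (\<integral>\<^sup>+p. ennreal ((step_value A \<xi> a b p)\<^sup>2) \<partial>path_measure M T)"
proof -
  let ?L = "restrict_space lborel {0..T}"
  interpret L: finite_measure ?L by (rule finite_measure_interval)
  have k: "0 \<le> a k" "a k \<le> b k" "b k \<le> T" "\<xi> k \<in> borel_measurable (\<F> (a k))" "square_integrable M (\<xi> k)"
    if "k \<in> A" for k
    using steps that by (auto simp: adapted_steps_def)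
  define c where "c k l = expectation (\<lambda>\<omega>. \<xi> k \<omega> * \<xi> l \<omega>)" for k l
  define \<mu> where "\<mu> k l = measure lborel ({a k<..b k} \<inter> {a l<..b l})" for k l
  let ?X = "\<lambda>k \<omega>. \<xi> k \<omega> * incr q (a k) (b k) \<omega>"
  have square_sum: "(\<Sum>k\<in>A. f k)\<^sup>2 = (\<Sum>k\<in>A. \<Sum>l\<in>A. f k * f l)" for f :: "_ \<Rightarrow> real"
    by (simp add: power2_eq_square sum_product)
  have X: "square_integrable M (?X k)" if "k \<in> A" for k
    using k[OF that] by (intro square_integrable_past_mult_incr)
  have "expectation (\<lambda>\<omega>. (step_integral A \<xi> a b (\<lambda>s \<omega>. B s \<omega> $ q) \<omega>)\<^sup>2)
      = (\<Sum>k\<in>A. \<Sum>l\<in>A. expectation (\<lambda>\<omega>. ?X k \<omega> * ?X l \<omega>))"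
    unfolding step_integral_def square_sum
    by (subst Bochner_Integration.integral_sum)
      (intro Bochner_Integration.integrable_sum square_integrable_mult X sum.cong refl
        Bochner_Integration.integral_sum; assumption)+
  also have "\<dots> = (\<Sum>k\<in>A. \<Sum>l\<in>A. \<Sigma> $ q $ q * c k l * \<mu> k l)"
    unfolding c_def \<mu>_def by (intro sum.cong refl expectation_increment_pair k)
  also have "\<dots> = \<Sigma> $ q $ q * (\<Sum>k\<in>A. \<Sum>l\<in>A. c k l * \<mu> k l)"
    by (simp add: sum_distrib_left mult.assoc)
  finally have left: "(\<integral>\<^sup>+\<omega>. ennreal ((step_integral A \<xi> a b (\<lambda>s \<omega>. B s \<omega> $ q) \<omega>)\<^sup>2) \<partial>M)
      = ennreal (\<Sigma> $ q $ q * (\<Sum>k\<in>A. \<Sum>l\<in>A. c k l * \<mu> k l))"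
    using nn_integral_eq_square_integrable[OF square_integrable_step_integral[OF steps]] by simp

  have v: "square_integrable M (\<lambda>\<omega>. step_value A \<xi> a b (\<omega>, s))" for s
    unfolding step_value_def case_prod_conv mult.commute[of _ "indicator _ _"]
    by (intro square_integrable_sum square_integrable_cmult k)
  let ?c = "\<lambda>s. \<Sum>k\<in>A. \<Sum>l\<in>A. c k l * indicator ({a k<..b k} \<inter> {a l<..b l}) s"
  have inner: "expectation (\<lambda>\<omega>. (step_value A \<xi> a b (\<omega>, s))\<^sup>2) = ?c s" for s
  proof -
    have "expectation (\<lambda>\<omega>. (step_value A \<xi> a b (\<omega>, s))\<^sup>2)
      = expectation (\<lambda>\<omega>. \<Sum>k\<in>A. \<Sum>l\<in>A. (\<xi> k \<omega> * \<xi> l \<omega>) * indicator ({a k<..b k} \<inter> {a l<..b l}) s)"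
      unfolding step_value_def case_prod_conv square_sum indicator_inter_arith by (simp add: mult_ac)
    also have "\<dots> = (\<Sum>k\<in>A. \<Sum>l\<in>A. expectation (\<lambda>\<omega>. (\<xi> k \<omega> * \<xi> l \<omega>) * indicator ({a k<..b k} \<inter> {a l<..b l}) s))"
      by (subst Bochner_Integration.integral_sum)
        (intro Bochner_Integration.integrable_sum integrable_mult_left square_integrable_mult k sum.cong refl
        Bochner_Integration.integral_sum; assumption)+
    also have "\<dots> = ?c s"
      by (simp add: c_def)
    finally show ?thesis .
  qed
  have meas: "measure ?L ({a k<..b k} \<inter> {a l<..b l}) = \<mu> k l" if "k \<in> A" "l \<in> A" for k l
    unfolding \<mu>_def using k[OF that(1)] k[OF that(2)] by (intro measure_restrict_space) auto
  have sets: "{a k<..b k} \<inter> {a l<..b l} \<in> sets ?L" if "k \<in> A" "l \<in> A" for k l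
    using k[OF that(1)] k[OF that(2)] by (auto simp: sets_restrict_space_iff)
  have indic: "integrable ?L (\<lambda>s. indicator ({a k<..b k} \<inter> {a l<..b l}) s :: real)" if "k \<in> A" "l \<in> A" for k l
    by (rule integrable_real_indicator[OF sets[OF that]]) (simp only: L.emeasure_finite less_top[symmetric] infinity_ennreal_def not_False_eq_True)
  have c_int: "integrable ?L ?c"
    by (intro Bochner_Integration.integrable_sum integrable_mult_right indic)
  have "(\<integral>s. ?c s \<partial>?L) = (\<Sum>k\<in>A. \<Sum>l\<in>A. \<integral>s. c k l * indicator ({a k<..b k} \<inter> {a l<..b l}) s \<partial>?L)"
    by (subst Bochner_Integration.integral_sum)
        (intro Bochner_Integration.integrable_sum integrable_mult_right indic sum.cong refl
        Bochner_Integration.integral_sum; assumption)+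
  also have "\<dots> = (\<Sum>k\<in>A. \<Sum>l\<in>A. c k l * \<mu> k l)"
  proof (intro sum.cong refl)
    fix k l assume kl: "k \<in> A" "l \<in> A"
    have "(\<integral>s. indicator ({a k<..b k} \<inter> {a l<..b l}) s \<partial>?L) = measure ?L ({a k<..b k} \<inter> {a l<..b l})"
      unfolding Bochner_Integration.integral_indicator Int_absorb2[OF sets.sets_into_space[OF sets[OF kl]]] ..
    then show "(\<integral>s. c k l * indicator ({a k<..b k} \<inter> {a l<..b l}) s \<partial>?L) = c k l * \<mu> k l"
      using meas[OF kl] by simp
  qed
  finally have c_val: "(\<integral>s. ?c s \<partial>?L) = (\<Sum>k\<in>A. \<Sum>l\<in>A. c k l * \<mu> k l)" .
  have c_nonneg: "0 \<le> ?c s" for s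
    unfolding inner[symmetric] by simp
  have [measurable]: "step_value A \<xi> a b \<in> borel_measurable (M \<Otimes>\<^sub>M ?L)"
    by (rule step_value_measurable[OF steps])
  have "(\<integral>\<^sup>+p. ennreal ((step_value A \<xi> a b p)\<^sup>2) \<partial>path_measure M T)
      = (\<integral>\<^sup>+s. \<integral>\<^sup>+\<omega>. ennreal ((step_value A \<xi> a b (\<omega>, s))\<^sup>2) \<partial>M \<partial>?L)"
    by (rule nn_integral_path_measure) measurable
  also have "\<dots> = (\<integral>\<^sup>+s. ennreal (?c s) \<partial>?L)"
    unfolding nn_integral_eq_square_integrable[OF v] inner ..
  also have "\<dots> = ennreal (\<Sum>k\<in>A. \<Sum>l\<in>A. c k l * \<mu> k l)"
    unfolding c_val[symmetric] by (rule nn_integral_eq_integral[OF c_int]) (simp only: c_nonneg AE_I2)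
  finally show ?thesis
    unfolding left using Sigma_diag_nonneg by (simp add: ennreal_mult')
qed

end

section \<open>Grid approximations of a component\<close>

lemma measurable_completion_cong_AE:
  assumes f: "f \<in> M \<rightarrow>\<^sub>M N" and g: "g \<in> space M \<rightarrow> space N" and eq: "AE x in M. f x = g x"
  shows "g \<in> completion M \<rightarrow>\<^sub>M N"
proof (rule measurableI)
  show "g x \<in> space N" if "x \<in> space (completion M)" for x
    using g that by auto
  fix A assume A: "A \<in> sets N"
  show "g -` A \<inter> space (completion M) \<in> sets (completion M)"
  proof (rule completion.in_sets_AE)
    show "f -` A \<inter> space M \<in> sets (completion M)"
      using measurable_sets[OF f A] by (rule sets_completionI_sets)
    show "AE x in completion M. (x \<in> f -` A \<inter> space M) = (x \<in> g -` A \<inter> space (completion M))"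
      using AE_completion[OF eq] by eventually_elim simp
  qed simp
qed

lemma AE_pair_measure_fst:
  assumes "sigma_finite_measure M" "sigma_finite_measure N" and P: "AE x in M. P x"
  shows "AE z in M \<Otimes>\<^sub>M N. P (fst z)"
proof -
  interpret pair_sigma_finite M N
    using assms by (simp add: pair_sigma_finite_def)
  obtain Z where Z: "Z \<in> sets M" "emeasure M Z = 0" "{x \<in> space M. \<not> P x} \<subseteq> Z"
    using P by (rule AE_E)
  have "Z \<in> null_sets M" using Z by auto
  have "AE z in M \<Otimes>\<^sub>M N. fst z \<notin> Z"
  proof (rule AE_pair_measure)
    have "{z \<in> space (M \<Otimes>\<^sub>M N). fst z \<notin> Z} = fst -` (space M - Z) \<inter> space (M \<Otimes>\<^sub>M N)"
      by (auto simp: space_pair_measure)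
    then show "{z \<in> space (M \<Otimes>\<^sub>M N). fst z \<notin> Z} \<in> sets (M \<Otimes>\<^sub>M N)"
      using Z(1) by (simp add: measurable_sets[OF measurable_fst])
    show "AE x in M. AE y in N. fst (x, y) \<notin> Z"
      using AE_not_in[OF \<open>Z \<in> null_sets M\<close>] by eventually_elim simp
  qed
  moreover have "AE z in M \<Otimes>\<^sub>M N. z \<in> space (M \<Otimes>\<^sub>M N)" by (rule AE_space)
  ultimately show ?thesis
    by eventually_elim (use Z(3) in \<open>auto simp: space_pair_measure\<close>)
qed

text \<open>The squared \<open>L\<^sup>2\<close>-error of a grid approximation is proportional to the mesh. With the mesh
  \<open>4 ^ -m\<close>, the grid sums are therefore Cauchy at the rate that
  \<open>L2_complete_geometric\<close> asks for.\<close>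

abbreviation grid :: "nat \<Rightarrow> nat \<Rightarrow> real" where
  "grid m k \<equiv> real k / 4 ^ m"

lemma grid_cell:
  assumes "0 < s" "s \<le> 1"
  obtains k where "k < 4 ^ m" "grid m k < s" "s \<le> grid m (Suc k)"
    "\<And>j. s \<in> {grid m j<..grid m (Suc j)} \<longleftrightarrow> j = k"
proof -
  \<comment> \<open>Cells are half-open on the left, so the cell of \<open>s\<close> ends at the ceiling of \<open>s * 4 ^ m\<close>.\<close>
  define r where "r = nat \<lceil>s * 4 ^ m\<rceil>"
  have pos: "0 < s * 4 ^ m" using assms by simp
  have "0 < r" using pos by (simp add: r_def)
  then obtain k where k: "r = Suc k" by (cases r) auto
  have cell: "real k < s * 4 ^ m \<and> s * 4 ^ m \<le> real (Suc k)"
  proof -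
    have "\<lceil>s * 4 ^ m\<rceil> = int (Suc k)" using k pos unfolding r_def by linarith
    then show ?thesis unfolding ceiling_eq_iff by simp
  qed
  show ?thesis
  proof
    have "s * 4 ^ m \<le> 4 ^ m" using assms(2) by simp
    then have "real k < real (4 ^ m)" unfolding of_nat_power of_nat_numeral using cell by linarith
    then show "k < 4 ^ m" by (rule of_nat_less_imp_less)
    show "grid m k < s" "s \<le> grid m (Suc k)"
      using cell by (simp_all add: field_simps)
    fix j
    have "s \<in> {grid m j<..grid m (Suc j)} \<longleftrightarrow> real j < s * 4 ^ m \<and> s * 4 ^ m \<le> real (Suc j)"
      by (simp add: field_simps)
    also have "\<dots> \<longleftrightarrow> j = k"
    proof
      assume "real j < s * 4 ^ m \<and> s * 4 ^ m \<le> real (Suc j)"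
      then have "real j < real (Suc k)" "real k < real (Suc j)" using cell by linarith+
      then show "j = k" by linarith
    qed (use cell in simp)
    finally show "s \<in> {grid m j<..grid m (Suc j)} \<longleftrightarrow> j = k" .
  qed
qed

context brownian
begin

lemma B_component_eq_incr: "AE \<omega> in M. B t \<omega> $ p = incr p 0 t \<omega>"
  using B_0 by eventually_elim simp

lemma square_integrable_B:
  assumes "0 \<le> t"
  shows "square_integrable M (\<lambda>\<omega>. B t \<omega> $ p)"
  unfolding square_integrable_def
proof
  show [measurable]: "(\<lambda>\<omega>. B t \<omega> $ p) \<in> borel_measurable M"
    using assms by (rule B_component_measurable)
  have "integrable M (\<lambda>\<omega>. (incr p 0 t \<omega>)\<^sup>2)"
    using square_integrable_incr[OF order_refl assms, of p] by (simp only: square_integrable_def)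
  then show "integrable M (\<lambda>\<omega>. (B t \<omega> $ p)\<^sup>2)"
  proof (rule integrable_cong_AE_imp)
    show "AE \<omega> in M. (incr p 0 t \<omega>)\<^sup>2 = (B t \<omega> $ p)\<^sup>2"
      using B_component_eq_incr[of t p] by eventually_elim simp
  qed measurable
qed

lemma covariance_B:
  assumes "0 \<le> t"
  shows "expectation (\<lambda>\<omega>. B t \<omega> $ p * B t \<omega> $ q) = t * \<Sigma> $ p $ q"
proof -
  have [measurable]: "(\<lambda>\<omega>. B t \<omega> $ r) \<in> borel_measurable M" "incr r 0 t \<in> borel_measurable M" for r
    using assms by (simp_all add: B_component_measurable incr_measurable)
  have "AE \<omega> in M. B t \<omega> $ p * B t \<omega> $ q = incr p 0 t \<omega> * incr q 0 t \<omega>"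
    using B_component_eq_incr[of t p] B_component_eq_incr[of t q] by eventually_elim simp
  then have "expectation (\<lambda>\<omega>. B t \<omega> $ p * B t \<omega> $ q) = expectation (\<lambda>\<omega>. incr p 0 t \<omega> * incr q 0 t \<omega>)"
    by (intro integral_cong_AE) measurable
  then show ?thesis using covariance_incr[OF order_refl assms, of p q] by (simp only: diff_zero)
qed

definition grid_value :: "'n \<Rightarrow> nat \<Rightarrow> 'w \<times> real \<Rightarrow> real" where
  "grid_value p m = step_value {..<4 ^ m} (\<lambda>k \<omega>. B (grid m k) \<omega> $ p) (grid m) (\<lambda>k. grid m (Suc k))"

definition grid_integral :: "'n \<Rightarrow> 'n \<Rightarrow> nat \<Rightarrow> 'w \<Rightarrow> real" where
  "grid_integral p q m =
    step_integral {..<4 ^ m} (\<lambda>k \<omega>. B (grid m k) \<omega> $ p) (grid m) (\<lambda>k. grid m (Suc k)) (\<lambda>s \<omega>. B s \<omega> $ q)"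

lemma grid_le_1: "k \<le> 4 ^ m \<Longrightarrow> grid m k \<le> 1"
proof -
  assume "k \<le> 4 ^ m"
  then have "real k \<le> real (4 ^ m)" by (rule of_nat_mono)
  then show ?thesis by simp
qed

lemma adapted_grid_steps:
  "adapted_steps 1 {..<4 ^ m} (\<lambda>k \<omega>. B (grid m k) \<omega> $ p) (grid m) (\<lambda>k. grid m (Suc k))"
  unfolding adapted_steps_def
proof (intro conjI ballI)
  fix k :: nat assume "k \<in> {..<4 ^ m}"
  then show "grid m (Suc k) \<le> 1" by (intro grid_le_1) simp
  show "(\<lambda>\<omega>. B (grid m k) \<omega> $ p) \<in> borel_measurable (\<F> (grid m k))"
    by (rule B_component_adapted) simp_all
  show "square_integrable M (\<lambda>\<omega>. B (grid m k) \<omega> $ p)"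
    by (rule square_integrable_B) simp
qed (simp_all add: divide_right_mono)

lemma grid_value_in_cell:
  assumes "0 < s" "s \<le> 1"
  obtains u where "0 \<le> u" "u \<le> s" "s - u \<le> 1 / 4 ^ m" "\<And>\<omega>. grid_value p m (\<omega>, s) = B u \<omega> $ p"
proof -
  obtain k where k: "k < 4 ^ m" "grid m k < s" "s \<le> grid m (Suc k)"
    "\<And>j. s \<in> {grid m j<..grid m (Suc j)} \<longleftrightarrow> j = k"
    using grid_cell[OF assms] by blast
  show ?thesis
  proof (rule that)
    show "0 \<le> grid m k" by simp
    show "grid m k \<le> s" using k(2) by simp
    show "s - grid m k \<le> 1 / 4 ^ m"
      using k(3) by (simp add: add_divide_distrib)
    fix \<omega>
    have "grid_value p m (\<omega>, s) = (\<Sum>j<4 ^ m. B (grid m j) \<omega> $ p * (if j = k then 1 else 0))"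
      unfolding grid_value_def step_value_def case_prod_conv indicator_def k(4) of_bool_def ..
    also have "\<dots> = (\<Sum>j<4 ^ m. if j = k then B (grid m k) \<omega> $ p else 0)"
      by (intro sum.cong) auto
    also have "\<dots> = B (grid m k) \<omega> $ p" using k(1) by (simp add: sum.delta)
    finally show "grid_value p m (\<omega>, s) = B (grid m k) \<omega> $ p" .
  qed
qed

lemma grid_value_0: "grid_value p m (\<omega>, 0) = 0"
  unfolding grid_value_def step_value_def case_prod_conv
  by (intro sum.neutral ballI) (simp add: indicator_def not_less)

lemma grid_value_tendsto:
  "AE \<omega> in M. \<forall>s\<in>{0..1}. (\<lambda>m. grid_value p m (\<omega>, s)) \<longlonglongrightarrow> B s \<omega> $ p"
  using B_0 paths_continuous
proof eventually_elim
  fix \<omega> assume zero: "B 0 \<omega> = 0" and cont: "continuous_on {0..} (\<lambda>t. B t \<omega>)"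
  show "\<forall>s\<in>{0..1}. (\<lambda>m. grid_value p m (\<omega>, s)) \<longlonglongrightarrow> B s \<omega> $ p"
  proof
    fix s :: real assume s: "s \<in> {0..1}"
    show "(\<lambda>m. grid_value p m (\<omega>, s)) \<longlonglongrightarrow> B s \<omega> $ p"
    proof (cases "s = 0")
      case True
      then show ?thesis using zero by (simp add: grid_value_0)
    next
      case False
      then have "0 < s" "s \<le> 1" using s by auto
      then have "\<exists>u. 0 \<le> u \<and> u \<le> s \<and> s - u \<le> 1 / 4 ^ m \<and> grid_value p m (\<omega>, s) = B u \<omega> $ p" for m
        by (metis grid_value_in_cell)
      then obtain u where u: "\<And>m. 0 \<le> u m" "\<And>m. u m \<le> s" "\<And>m. s - u m \<le> 1 / 4 ^ m"
        "\<And>m. grid_value p m (\<omega>, s) = B (u m) \<omega> $ p"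
        by metis
      have "(\<lambda>m. (1 / 4) ^ m :: real) \<longlonglongrightarrow> 0" by (rule LIMSEQ_power_zero) simp
      then have "(\<lambda>m. s - (1 / 4) ^ m) \<longlonglongrightarrow> s - 0" by (intro tendsto_diff tendsto_const)
      moreover have "s - (1 / 4) ^ m \<le> u m" for m
        using u(3)[of m] by (simp add: power_one_over)
      ultimately have "u \<longlonglongrightarrow> s"
        using u(2) by (intro tendsto_sandwich[of "\<lambda>m. s - (1 / 4) ^ m" u sequentially "\<lambda>_. s"]) simp_all
      then have "(\<lambda>m. B (u m) \<omega>) \<longlonglongrightarrow> B s \<omega>"
        using u(1) s by (intro continuous_on_tendsto_compose[OF cont]) simp_all
      then show ?thesis unfolding u(4) by (rule tendsto_vec_nth)
    qed
  qed
qed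

abbreviation component :: "'n \<Rightarrow> 'w \<times> real \<Rightarrow> real" where
  "component p \<equiv> \<lambda>(\<omega>, s). B s \<omega> $ p"

text \<open>Only almost all paths are continuous, so \<open>(\<omega>, s) \<mapsto> B s \<omega> $ p\<close> need not be measurable for the
  product sigma-algebra, but only for its completion. This limit of grid processes is a
  product-measurable version of it, to which Tonelli's theorem applies.\<close>

definition component_version :: "'n \<Rightarrow> 'w \<times> real \<Rightarrow> real" where
  "component_version p z = lim (\<lambda>m. grid_value p m z)"

lemma grid_value_measurable: "grid_value p m \<in> borel_measurable (M \<Otimes>\<^sub>M restrict_space lborel {0..1})"
  unfolding grid_value_def by (rule step_value_measurable[OF adapted_grid_steps])

lemma component_version_measurable:
  "component_version p \<in> borel_measurable (M \<Otimes>\<^sub>M restrict_space lborel {0..1})"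
  unfolding component_version_def[abs_def] by (intro borel_measurable_lim_metric grid_value_measurable)

lemma component_version_eq:
  "AE \<omega> in M. \<forall>s\<in>{0..1}. component_version p (\<omega>, s) = B s \<omega> $ p"
  using grid_value_tendsto[of p] by eventually_elim (auto simp: component_version_def intro: limI)

lemma component_version_eq_pair:
  "AE z in M \<Otimes>\<^sub>M restrict_space lborel {0..1}. component_version p z = component p z"
proof -
  interpret L: finite_measure "restrict_space lborel {0..1::real}" by (rule finite_measure_interval)
  have "AE z in M \<Otimes>\<^sub>M restrict_space lborel {0..1::real}.
      \<forall>s\<in>{0..1}. component_version p (fst z, s) = B s (fst z) $ p"
    by (rule AE_pair_measure_fst[OF sigma_finite_measure_axioms L.sigma_finite_measure_axioms
          component_version_eq])
  moreover have "AE z in M \<Otimes>\<^sub>M restrict_space lborel {0..1::real}. z \<in> space (M \<Otimes>\<^sub>M restrict_space lborel {0..1::real})"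
    by (rule AE_space)
  ultimately show ?thesis
    by eventually_elim (auto simp: space_pair_measure space_restrict_space)
qed

lemma component_measurable: "component p \<in> borel_measurable (path_measure M 1)"
  unfolding path_measure_def
  by (rule measurable_completion_cong_AE[OF component_version_measurable _ component_version_eq_pair]) simp

lemma step_value_path_measurable:
  "adapted_steps T A \<xi> a b \<Longrightarrow> step_value A \<xi> a b \<in> borel_measurable (path_measure M T)"
  unfolding path_measure_def by (intro measurable_completion step_value_measurable)

lemma grid_value_path_measurable: "grid_value p m \<in> borel_measurable (path_measure M 1)"
  unfolding grid_value_def by (rule step_value_path_measurable[OF adapted_grid_steps])

text \<open>In a cell the grid process has the value of \<open>B\<close> at a time \<open>u \<le> s\<close> within the mesh of \<open>s\<close>, and
  the increment over \<open>[u, s]\<close> has variance \<open>(s - u) \<sigma>\<^sub>p\<^sub>p\<close>.\<close>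

lemma grid_value_error:
  "(\<integral>\<^sup>+z. ennreal ((grid_value p m z - component p z)\<^sup>2) \<partial>path_measure M 1) \<le> ennreal (\<Sigma> $ p $ p / 4 ^ m)"
proof -
  let ?L = "restrict_space lborel {0..1::real}"
  note [measurable] = component_version_measurable grid_value_measurable
  have "(\<integral>\<^sup>+z. ennreal ((grid_value p m z - component p z)\<^sup>2) \<partial>path_measure M 1)
      = (\<integral>\<^sup>+z. ennreal ((grid_value p m z - component_version p z)\<^sup>2) \<partial>path_measure M 1)"
  proof (rule nn_integral_cong_AE)
    show "AE z in path_measure M 1. ennreal ((grid_value p m z - component p z)\<^sup>2)
        = ennreal ((grid_value p m z - component_version p z)\<^sup>2)"
      unfolding path_measure_def
      using AE_completion[OF component_version_eq_pair[of p]] by eventually_elim simp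
  qed
  also have "\<dots> = (\<integral>\<^sup>+s. \<integral>\<^sup>+\<omega>. ennreal ((grid_value p m (\<omega>, s) - component_version p (\<omega>, s))\<^sup>2) \<partial>M \<partial>?L)"
    by (rule nn_integral_path_measure) measurable
  also have "\<dots> \<le> (\<integral>\<^sup>+s. ennreal (\<Sigma> $ p $ p / 4 ^ m) \<partial>?L)"
  proof (rule nn_integral_mono)
    fix s assume "s \<in> space ?L"
    then have s: "0 \<le> s" "s \<le> 1" by (auto simp: space_restrict_space)
    have eq: "(\<integral>\<^sup>+\<omega>. ennreal ((grid_value p m (\<omega>, s) - component_version p (\<omega>, s))\<^sup>2) \<partial>M)
        = (\<integral>\<^sup>+\<omega>. ennreal ((grid_value p m (\<omega>, s) - B s \<omega> $ p)\<^sup>2) \<partial>M)"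
    proof (rule nn_integral_cong_AE)
      show "AE \<omega> in M. ennreal ((grid_value p m (\<omega>, s) - component_version p (\<omega>, s))\<^sup>2)
        = ennreal ((grid_value p m (\<omega>, s) - B s \<omega> $ p)\<^sup>2)"
        using component_version_eq[of p] by eventually_elim (use s in simp)
    qed
    show "(\<integral>\<^sup>+\<omega>. ennreal ((grid_value p m (\<omega>, s) - component_version p (\<omega>, s))\<^sup>2) \<partial>M)
        \<le> ennreal (\<Sigma> $ p $ p / 4 ^ m)"
    proof (cases "s = 0")
      case True
      have "(\<integral>\<^sup>+\<omega>. ennreal ((grid_value p m (\<omega>, s) - B s \<omega> $ p)\<^sup>2) \<partial>M) = (\<integral>\<^sup>+\<omega>. 0 \<partial>M)"
      proof (rule nn_integral_cong_AE)
        show "AE \<omega> in M. ennreal ((grid_value p m (\<omega>, s) - B s \<omega> $ p)\<^sup>2) = 0"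
          using B_0 by eventually_elim (simp add: True grid_value_0)
      qed
      then show ?thesis unfolding eq by simp
    next
      case False
      then obtain u where u: "0 \<le> u" "u \<le> s" "s - u \<le> 1 / 4 ^ m" "\<And>\<omega>. grid_value p m (\<omega>, s) = B u \<omega> $ p"
        using grid_value_in_cell[of s m p] s by (metis order_le_less)
      have "(\<integral>\<^sup>+\<omega>. ennreal ((grid_value p m (\<omega>, s) - B s \<omega> $ p)\<^sup>2) \<partial>M)
          = ennreal (expectation (\<lambda>\<omega>. (incr p u s \<omega>)\<^sup>2))"
        unfolding u(4) power2_commute[of "B u _ $ p"]
        by (rule nn_integral_eq_square_integrable[OF square_integrable_incr[OF u(1,2)]])
      also have "expectation (\<lambda>\<omega>. (incr p u s \<omega>)\<^sup>2) = (s - u) * \<Sigma> $ p $ p"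
        unfolding power2_eq_square by (rule covariance_incr[OF u(1,2)])
      also have "\<dots> \<le> 1 / 4 ^ m * \<Sigma> $ p $ p"
        by (intro mult_right_mono u Sigma_diag_nonneg)
      finally show ?thesis unfolding eq by (simp add: ennreal_leI)
    qed
  qed
  also have "\<dots> = ennreal (\<Sigma> $ p $ p / 4 ^ m)"
    by (simp add: emeasure_restrict_space space_restrict_space)
  finally show ?thesis .
qed

end

section \<open>Existence and uniqueness of the integral of a component\<close>

context brownian
begin

lemma Ito_isometry_diff:
  assumes "adapted_steps T A \<xi> a b" "adapted_steps T A' \<xi>' a' b'"
  shows "(\<integral>\<^sup>+\<omega>. ennreal ((step_integral A \<xi> a b (\<lambda>s \<omega>. B s \<omega> $ q) \<omega>
        - step_integral A' \<xi>' a' b' (\<lambda>s \<omega>. B s \<omega> $ q) \<omega>)\<^sup>2) \<partial>M)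
    = ennreal (\<Sigma> $ q $ q) * (\<integral>\<^sup>+z. ennreal ((step_value A \<xi> a b z - step_value A' \<xi>' a' b' z)\<^sup>2) \<partial>path_measure M T)"
proof -
  let ?A = "A <+> A'" and ?\<xi> = "case_sum \<xi> (\<lambda>k \<omega>. - \<xi>' k \<omega>)"
    and ?a = "case_sum a a'" and ?b = "case_sum b b'"
  have fin: "finite A" "finite A'" using assms by (auto simp: adapted_steps_def)
  have "adapted_steps T ?A ?\<xi> ?a ?b"
    unfolding adapted_steps_def
  proof (intro conjI ballI)
    fix k assume "k \<in> ?A"
    then consider i where "k = Inl i" "i \<in> A" | i where "k = Inr i" "i \<in> A'" by auto
    note cases = this
    show "0 \<le> ?a k" "?a k \<le> ?b k" "?b k \<le> T"
      by (cases rule: cases; use assms in \<open>simp add: adapted_steps_def\<close>)+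
    show "?\<xi> k \<in> borel_measurable (\<F> (?a k))"
      by (cases rule: cases; use assms in \<open>simp add: adapted_steps_def\<close>)
    show "square_integrable M (?\<xi> k)"
    proof (cases rule: cases)
      case (2 i)
      then have "square_integrable M (\<lambda>\<omega>. -1 * \<xi>' i \<omega>)"
        using assms(2) by (intro square_integrable_cmult) (simp add: adapted_steps_def)
      then show ?thesis by (simp add: 2)
    qed (use assms in \<open>simp add: adapted_steps_def\<close>)
  qed (use fin in simp)
  then have "(\<integral>\<^sup>+\<omega>. ennreal ((step_integral ?A ?\<xi> ?a ?b (\<lambda>s \<omega>. B s \<omega> $ q) \<omega>)\<^sup>2) \<partial>M)
    = ennreal (\<Sigma> $ q $ q) * (\<integral>\<^sup>+z. ennreal ((step_value ?A ?\<xi> ?a ?b z)\<^sup>2) \<partial>path_measure M T)"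
    by (rule Ito_isometry)
  moreover have "step_integral ?A ?\<xi> ?a ?b W \<omega> = step_integral A \<xi> a b W \<omega> - step_integral A' \<xi>' a' b' W \<omega>"
    for W \<omega>
    by (simp add: step_integral_def sum.Plus[OF fin] o_def sum_negf)
  moreover have "step_value ?A ?\<xi> ?a ?b z = step_value A \<xi> a b z - step_value A' \<xi>' a' b' z" for z
    by (simp add: step_value_def sum.Plus[OF fin] o_def sum_negf case_prod_unfold)
  ultimately show ?thesis by simp
qed

lemma square_integrable_grid_integral: "square_integrable M (grid_integral p q m)"
  unfolding grid_integral_def[abs_def] by (rule square_integrable_step_integral[OF adapted_grid_steps])

lemma grid_integral_measurable: "grid_integral p q m \<in> borel_measurable M"
  by (rule square_integrable_measurable[OF square_integrable_grid_integral])

lemma grid_value_tendsto_L2: "tendsto_L2 (path_measure M 1) (grid_value p) (component p)"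
  unfolding tendsto_L2_def
proof (rule tendsto_ennreal_sandwich_0[OF _ grid_value_error])
  have "(\<lambda>m. \<Sigma> $ p $ p * (1/4) ^ m) \<longlonglongrightarrow> \<Sigma> $ p $ p * 0"
    by (intro tendsto_mult tendsto_const LIMSEQ_power_zero) simp
  then have "(\<lambda>m. \<Sigma> $ p $ p / 4 ^ m) \<longlonglongrightarrow> 0" by (simp add: power_one_over)
  then show "(\<lambda>m. ennreal (\<Sigma> $ p $ p / 4 ^ m)) \<longlonglongrightarrow> 0"
    unfolding ennreal_0[symmetric] by (rule tendsto_ennrealI)
qed

lemma ito_integrand_component: "ito_integrand M \<F> 1 (\<lambda>s \<omega>. B s \<omega> $ p)"
  unfolding ito_integrand_def
proof (intro conjI ballI)
  show "component p \<in> borel_measurable (path_measure M 1)" by (rule component_measurable)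
  show "(\<lambda>\<omega>. B s \<omega> $ p) \<in> borel_measurable (\<F> s)" if "s \<in> {0..1}" for s
    using that by (intro B_component_adapted) auto
  interpret L: finite_measure "restrict_space lborel {0..1::real}" by (rule finite_measure_interval)
  \<comment> \<open>The coarsest grid process is almost surely zero, so its error is the norm of the integrand.\<close>
  have "AE z in path_measure M 1. B 0 (fst z) = 0"
    unfolding path_measure_def
    by (intro AE_completion AE_pair_measure_fst[OF sigma_finite_measure_axioms L.sigma_finite_measure_axioms B_0])
  then have "(\<integral>\<^sup>+z. ennreal ((component p z)\<^sup>2) \<partial>path_measure M 1)
      = (\<integral>\<^sup>+z. ennreal ((grid_value p 0 z - component p z)\<^sup>2) \<partial>path_measure M 1)"
    by (intro nn_integral_cong_AE, eventually_elim)
      (simp add: grid_value_def step_value_def case_prod_unfold)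
  also have "\<dots> \<le> ennreal (\<Sigma> $ p $ p / 4 ^ 0)" by (rule grid_value_error)
  also have "\<dots> < \<infinity>" by simp
  finally show "(\<integral>\<^sup>+(\<omega>, s). ennreal ((B s \<omega> $ p)\<^sup>2) \<partial>path_measure M 1) < \<infinity>"
    by (simp add: case_prod_unfold)
qed

lemma grid_integral_diff:
  "(\<integral>\<^sup>+\<omega>. ennreal ((grid_integral p q m \<omega> - grid_integral p q k \<omega>)\<^sup>2) \<partial>M)
    = ennreal (\<Sigma> $ q $ q) * (\<integral>\<^sup>+z. ennreal ((grid_value p m z - grid_value p k z)\<^sup>2) \<partial>path_measure M 1)"
  unfolding grid_integral_def grid_value_def
  by (rule Ito_isometry_diff[OF adapted_grid_steps adapted_grid_steps])

lemma Ito_integral_exists: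
  "\<exists>J. has_ito_integral M \<F> (\<lambda>s \<omega>. B s \<omega> $ q) 1 (\<lambda>s \<omega>. B s \<omega> $ p) J"
proof -
  let ?P = "path_measure M 1"
  let ?c = "4 * \<Sigma> $ p $ p * \<Sigma> $ q $ q"
  have c: "0 \<le> ?c" by (intro mult_nonneg_nonneg Sigma_diag_nonneg) simp
  have "(\<integral>\<^sup>+\<omega>. ennreal ((grid_integral p q m \<omega> - grid_integral p q k \<omega>)\<^sup>2) \<partial>M) \<le> ennreal (?c / 4 ^ m)"
    if "m \<le> k" for m k
  proof -
    have "(\<integral>\<^sup>+z. ennreal ((grid_value p m z - grid_value p k z)\<^sup>2) \<partial>?P)
        \<le> 2 * (\<integral>\<^sup>+z. ennreal ((grid_value p m z - component p z)\<^sup>2) \<partial>?P)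
          + 2 * (\<integral>\<^sup>+z. ennreal ((component p z - grid_value p k z)\<^sup>2) \<partial>?P)"
      by (rule nn_integral_square_triangle)
        (rule grid_value_path_measurable component_measurable)+
    also have "\<dots> \<le> 2 * ennreal (\<Sigma> $ p $ p / 4 ^ m) + 2 * ennreal (\<Sigma> $ p $ p / 4 ^ m)"
    proof (intro add_mono mult_left_mono grid_value_error)
      have "(\<integral>\<^sup>+z. ennreal ((component p z - grid_value p k z)\<^sup>2) \<partial>?P) \<le> ennreal (\<Sigma> $ p $ p / 4 ^ k)"
        unfolding power2_commute[of "component p _"] by (rule grid_value_error)
      also have "\<dots> \<le> ennreal (\<Sigma> $ p $ p / 4 ^ m)"
        using that Sigma_diag_nonneg[of p] by (intro ennreal_leI divide_left_mono power_increasing) simp_all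
      finally show "(\<integral>\<^sup>+z. ennreal ((component p z - grid_value p k z)\<^sup>2) \<partial>?P) \<le> ennreal (\<Sigma> $ p $ p / 4 ^ m)" .
    qed simp_all
    also have "\<dots> = ennreal (4 * \<Sigma> $ p $ p / 4 ^ m)"
    proof -
      define x where "x = \<Sigma> $ p $ p / 4 ^ m"
      have x: "0 \<le> x" using Sigma_diag_nonneg[of p] by (simp add: x_def)
      have "ennreal (4 * x) = ennreal (2 * x + 2 * x)" by simp
      also have "\<dots> = 2 * ennreal x + 2 * ennreal x"
        using x by (subst ennreal_plus) (simp_all add: ennreal_mult')
      finally show ?thesis by (simp add: x_def)
    qed
    finally have "(\<integral>\<^sup>+z. ennreal ((grid_value p m z - grid_value p k z)\<^sup>2) \<partial>?P) \<le> ennreal (4 * \<Sigma> $ p $ p / 4 ^ m)" .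
    then have "ennreal (\<Sigma> $ q $ q) * (\<integral>\<^sup>+z. ennreal ((grid_value p m z - grid_value p k z)\<^sup>2) \<partial>?P)
        \<le> ennreal (\<Sigma> $ q $ q) * ennreal (4 * \<Sigma> $ p $ p / 4 ^ m)"
      by (rule mult_left_mono) simp
    also have "\<dots> = ennreal (?c / 4 ^ m)"
      using Sigma_diag_nonneg[of q] by (subst ennreal_mult'[symmetric]) (simp_all add: mult_ac)
    finally show ?thesis unfolding grid_integral_diff .
  qed
  then obtain J where J: "J \<in> borel_measurable M" "tendsto_L2 M (grid_integral p q) J"
    using L2_complete_geometric[of "grid_integral p q", OF grid_integral_measurable c] by blast
  have "has_ito_integral M \<F> (\<lambda>s \<omega>. B s \<omega> $ q) 1 (\<lambda>s \<omega>. B s \<omega> $ p) J"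
    unfolding has_ito_integral_def
  proof (intro conjI exI allI)
    show "ito_integrand M \<F> 1 (\<lambda>s \<omega>. B s \<omega> $ p)" by (rule ito_integrand_component)
    show "J \<in> borel_measurable M" by (rule J)
    show "simple_process M \<F> 1 (4 ^ m) (grid m) (\<lambda>k \<omega>. B (grid m k) \<omega> $ p)" for m
      using adapted_grid_steps[of m p] grid_le_1[of _ m]
      by (auto simp: simple_process_def adapted_steps_def square_integrable_def)
    show "(\<lambda>m. \<integral>\<^sup>+(\<omega>, s). ennreal ((simple_process_value (4 ^ m) (grid m) (\<lambda>k \<omega>. B (grid m k) \<omega> $ p) s \<omega>
        - B s \<omega> $ p)\<^sup>2) \<partial>path_measure M 1) \<longlonglongrightarrow> 0"
      using grid_value_tendsto_L2[of p]
      by (simp add: tendsto_L2_def grid_value_def step_value_def simple_process_value_def case_prod_unfold)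
    show "(\<lambda>m. \<integral>\<^sup>+\<omega>. ennreal ((simple_integral (4 ^ m) (grid m) (\<lambda>k \<omega>. B (grid m k) \<omega> $ p)
        (\<lambda>s \<omega>. B s \<omega> $ q) \<omega> - J \<omega>)\<^sup>2) \<partial>M) \<longlonglongrightarrow> 0"
      using J(2) by (simp add: tendsto_L2_def grid_integral_def step_integral_def simple_integral_def)
  qed
  then show ?thesis by (rule exI[of _ J])
qed

text \<open>Uniqueness of the Ito integral, in the form needed here: an arbitrary approximating sequence
  and the grid processes have the same limit in \<open>L\<^sup>2\<close> of the path measure, so by the
  isometry their integrals have the same limit in \<open>L\<^sup>2(M)\<close>.\<close>

lemma grid_integral_tendsto_Ito_integral:
  assumes "has_ito_integral M \<F> (\<lambda>s \<omega>. B s \<omega> $ q) 1 (\<lambda>s \<omega>. B s \<omega> $ p) J"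
  shows "tendsto_L2 M (grid_integral p q) J"
proof -
  let ?P = "path_measure M 1"
  obtain n t \<xi> where sp: "\<And>m. simple_process M \<F> 1 (n m) (t m) (\<xi> m)"
    and val: "(\<lambda>m. \<integral>\<^sup>+(\<omega>, s). ennreal ((simple_process_value (n m) (t m) (\<xi> m) s \<omega> - B s \<omega> $ p)\<^sup>2) \<partial>?P) \<longlonglongrightarrow> 0"
    and int: "(\<lambda>m. \<integral>\<^sup>+\<omega>. ennreal ((simple_integral (n m) (t m) (\<xi> m) (\<lambda>s \<omega>. B s \<omega> $ q) \<omega> - J \<omega>)\<^sup>2) \<partial>M) \<longlonglongrightarrow> 0"
    and J: "J \<in> borel_measurable M"
    using assms unfolding has_ito_integral_def by blast
  have steps: "adapted_steps 1 {..<n m} (\<xi> m) (t m) (\<lambda>k. t m (Suc k))" for m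
    unfolding adapted_steps_def
  proof (intro conjI ballI)
    fix k assume "k \<in> {..<n m}"
    then have k: "k < n m" "k \<le> n m" "Suc k \<le> n m" by auto
    note s = sp[of m, unfolded simple_process_def]
    show "0 \<le> t m k" "t m (Suc k) \<le> 1" using s k by blast+
    show "t m k \<le> t m (Suc k)" using s k by blast
    show \<xi>: "\<xi> m k \<in> borel_measurable (\<F> (t m k))" using s k by blast
    show "square_integrable M (\<xi> m k)"
      unfolding square_integrable_def using measurable_from_filtration[OF \<xi>] s k by blast
  qed simp
  define v where "v m = step_value {..<n m} (\<xi> m) (t m) (\<lambda>k. t m (Suc k))" for m
  define I where "I m = step_integral {..<n m} (\<xi> m) (t m) (\<lambda>k. t m (Suc k)) (\<lambda>s \<omega>. B s \<omega> $ q)" for m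
  have v_meas: "v m \<in> borel_measurable ?P" for m
    unfolding v_def by (rule step_value_path_measurable[OF steps])
  have I_meas: "I m \<in> borel_measurable M" for m
    unfolding I_def by (rule square_integrable_measurable[OF square_integrable_step_integral[OF steps]])
  have v: "tendsto_L2 ?P v (component p)"
    using val by (simp add: tendsto_L2_def v_def step_value_def simple_process_value_def case_prod_unfold)
  have I: "tendsto_L2 M I J"
    using int by (simp add: tendsto_L2_def I_def step_integral_def simple_integral_def)
  have iso: "(\<integral>\<^sup>+\<omega>. ennreal ((grid_integral p q m \<omega> - I m \<omega>)\<^sup>2) \<partial>M)
      = ennreal (\<Sigma> $ q $ q) * (\<integral>\<^sup>+z. ennreal ((grid_value p m z - v m z)\<^sup>2) \<partial>?P)" for m
    unfolding grid_integral_def grid_value_def v_def I_def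
    by (rule Ito_isometry_diff[OF adapted_grid_steps steps])
  have "(\<lambda>m. \<integral>\<^sup>+z. ennreal ((grid_value p m z - v m z)\<^sup>2) \<partial>?P) \<longlonglongrightarrow> 0"
  proof (rule tendsto_ennreal_sandwich_0)
    show "(\<integral>\<^sup>+z. ennreal ((grid_value p m z - v m z)\<^sup>2) \<partial>?P)
        \<le> 2 * (\<integral>\<^sup>+z. ennreal ((grid_value p m z - component p z)\<^sup>2) \<partial>?P)
          + 2 * (\<integral>\<^sup>+z. ennreal ((component p z - v m z)\<^sup>2) \<partial>?P)" for m
      by (rule nn_integral_square_triangle[OF grid_value_path_measurable component_measurable v_meas])
    have "(\<lambda>m. \<integral>\<^sup>+z. ennreal ((component p z - v m z)\<^sup>2) \<partial>?P) \<longlonglongrightarrow> 0"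
      using v unfolding tendsto_L2_def power2_commute[of "component p _"] .
    then have "(\<lambda>m. 2 * (\<integral>\<^sup>+z. ennreal ((grid_value p m z - component p z)\<^sup>2) \<partial>?P)
          + 2 * (\<integral>\<^sup>+z. ennreal ((component p z - v m z)\<^sup>2) \<partial>?P)) \<longlonglongrightarrow> 2 * 0 + 2 * 0"
      using grid_value_tendsto_L2[of p] unfolding tendsto_L2_def
      by (intro tendsto_add ennreal_tendsto_cmult) simp_all
    then show "(\<lambda>m. 2 * (\<integral>\<^sup>+z. ennreal ((grid_value p m z - component p z)\<^sup>2) \<partial>?P)
          + 2 * (\<integral>\<^sup>+z. ennreal ((component p z - v m z)\<^sup>2) \<partial>?P)) \<longlonglongrightarrow> 0"
      by simp
  qed
  then have "(\<lambda>m. ennreal (\<Sigma> $ q $ q) * (\<integral>\<^sup>+z. ennreal ((grid_value p m z - v m z)\<^sup>2) \<partial>?P))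
      \<longlonglongrightarrow> ennreal (\<Sigma> $ q $ q) * 0"
    by (intro ennreal_tendsto_cmult) simp_all
  then have "(\<lambda>m. \<integral>\<^sup>+\<omega>. ennreal ((grid_integral p q m \<omega> - I m \<omega>)\<^sup>2) \<partial>M) \<longlonglongrightarrow> 0"
    unfolding iso by simp
  then show ?thesis
    by (rule tendsto_L2_if_difference_vanishes[OF I_meas grid_integral_measurable J _ I])
qed

end

section \<open>Quadratic covariation and integration by parts\<close>

lemma grid_cells_disjoint:
  assumes "k \<noteq> l"
  shows "{grid m k<..grid m (Suc k)} \<inter> {grid m l<..grid m (Suc l)} = {}"
proof -
  have "grid m (Suc k) \<le> grid m l \<or> grid m (Suc l) \<le> grid m k"
    using assms by (auto simp: divide_right_mono nat_neq_iff)
  then show ?thesis by auto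
qed

lemma grid_mono: "k \<le> l \<Longrightarrow> grid m k \<le> grid m l"
  by (simp add: divide_right_mono)

lemma grid_step: "grid m (Suc k) - grid m k = 1 / 4 ^ m"
  by (simp add: add_divide_distrib)

lemma sum_grid_tendsto: "(\<lambda>m. \<Sum>k<4 ^ m. grid m k / 4 ^ m) \<longlonglongrightarrow> 1 / 2"
proof -
  have gauss: "(\<Sum>k<n. real k) = real n * (real n - 1) / 2" for n
    by (induction n) (simp_all add: field_simps)
  have "(\<Sum>k<4 ^ m. grid m k / 4 ^ m) = 1 / 2 - 1 / 2 * (1 / 4) ^ m" for m
  proof -
    have "(\<Sum>k<4 ^ m. grid m k / 4 ^ m) = (\<Sum>k<4 ^ m. real k) / 4 ^ m / 4 ^ m"
      by (simp only: sum_divide_distrib)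
    also have "\<dots> = 1 / 2 - 1 / 2 * (1 / 4) ^ m"
      unfolding gauss by (simp add: field_simps power_one_over)
    finally show ?thesis .
  qed
  moreover have "(\<lambda>m. 1 / 2 - 1 / 2 * (1 / 4 :: real) ^ m) \<longlonglongrightarrow> 1 / 2 - 1 / 2 * 0"
    by (intro tendsto_diff tendsto_mult tendsto_const LIMSEQ_power_zero) simp
  ultimately show ?thesis by simp
qed

context brownian
begin

definition covariation_error :: "'n \<Rightarrow> 'n \<Rightarrow> nat \<Rightarrow> nat \<Rightarrow> 'w \<Rightarrow> real" where
  "covariation_error p q m k \<omega> =
    incr p (grid m k) (grid m (Suc k)) \<omega> * incr q (grid m k) (grid m (Suc k)) \<omega> - \<Sigma> $ p $ q / 4 ^ m"

lemma square_integrable_covariation_error: "square_integrable M (covariation_error p q m k)"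
  unfolding covariation_error_def[abs_def]
  by (intro square_integrable_diff square_integrable_const square_integrable_incr_mult grid_mono) simp_all

lemma expectation_covariation_error: "expectation (covariation_error p q m k) = 0"
proof -
  have t: "0 \<le> grid m k" "grid m k \<le> grid m (Suc k)" by (simp_all only: grid_mono) simp_all
  have "expectation (covariation_error p q m k)
      = expectation (\<lambda>\<omega>. incr p (grid m k) (grid m (Suc k)) \<omega> * incr q (grid m k) (grid m (Suc k)) \<omega>)
        - expectation (\<lambda>\<omega>. \<Sigma> $ p $ q / 4 ^ m)"
    unfolding covariation_error_def[abs_def]
    by (intro Bochner_Integration.integral_diff integrable_if_square_integrable
        square_integrable_incr_mult[OF t] square_integrable_const)
  also have "\<dots> = 0"
    unfolding covariance_incr[OF t] grid_step by (simp add: prob_space)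
  finally show ?thesis .
qed

lemma covariation_errors_orthogonal:
  assumes "k < l"
  shows "expectation (\<lambda>\<omega>. covariation_error p q m k \<omega> * covariation_error p q m l \<omega>) = 0"
proof -
  have t: "0 \<le> grid m l" "grid m l \<le> grid m (Suc l)" by (simp_all only: grid_mono) simp_all
  let ?g = "\<lambda>x. x $ p * x $ q - \<Sigma> $ p $ q / 4 ^ m"
  have g: "?g (B (grid m (Suc l)) \<omega> - B (grid m l) \<omega>) = covariation_error p q m l \<omega>" for \<omega>
    by (simp only: covariation_error_def vector_minus_component)
  have past: "(\<lambda>\<omega>. B (grid m j) \<omega> $ r) \<in> borel_measurable (\<F> (grid m l))" if "j \<le> l" for j r
    using that by (intro B_component_adapted grid_mono) simp_all
  have "expectation (\<lambda>\<omega>. covariation_error p q m k \<omega> * ?g (B (grid m (Suc l)) \<omega> - B (grid m l) \<omega>))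
     = expectation (covariation_error p q m k) * expectation (\<lambda>\<omega>. ?g (B (grid m (Suc l)) \<omega> - B (grid m l) \<omega>))"
  proof (rule indep_past_incr(2)[OF t])
    show "covariation_error p q m k \<in> borel_measurable (\<F> (grid m l))"
      unfolding covariation_error_def[abs_def] using assms
      by (intro borel_measurable_diff borel_measurable_times borel_measurable_const past) simp_all
    show "integrable M (covariation_error p q m k)"
      "integrable M (\<lambda>\<omega>. ?g (B (grid m (Suc l)) \<omega> - B (grid m l) \<omega>))"
      unfolding g by (rule integrable_if_square_integrable[OF square_integrable_covariation_error])+
    show "?g \<in> borel_measurable borel" by measurable
  qed
  then show ?thesis unfolding g expectation_covariation_error by simp
qed

lemma covariation_error_bound:
  "expectation (\<lambda>\<omega>. (covariation_error p q m k \<omega>)\<^sup>2)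
    \<le> 3 / 2 * ((\<Sigma> $ p $ p)\<^sup>2 + (\<Sigma> $ q $ q)\<^sup>2) * (1 / 4 ^ m)\<^sup>2"
proof -
  have t: "0 \<le> grid m k" "grid m k \<le> grid m (Suc k)" by (simp_all only: grid_mono) simp_all
  let ?D = "\<lambda>\<omega>. incr p (grid m k) (grid m (Suc k)) \<omega> * incr q (grid m k) (grid m (Suc k)) \<omega>"
  let ?c = "\<Sigma> $ p $ q / 4 ^ m"
  note D = square_integrable_incr_mult[OF t, of p q]
  have D2: "integrable M (\<lambda>\<omega>. (?D \<omega>)\<^sup>2)" using D(1) by (simp only: square_integrable_def)
  note E = square_integrable_covariation_error[of p q m k]
  have "expectation (\<lambda>\<omega>. (?D \<omega>)\<^sup>2)
      = expectation (\<lambda>\<omega>. (covariation_error p q m k \<omega>)\<^sup>2 + (2 * ?c * covariation_error p q m k \<omega> + ?c\<^sup>2))"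
    by (intro Bochner_Integration.integral_cong)
      (simp_all add: covariation_error_def power2_eq_square algebra_simps)
  also have "\<dots> = expectation (\<lambda>\<omega>. (covariation_error p q m k \<omega>)\<^sup>2) + ?c\<^sup>2"
    using E integrable_if_square_integrable[OF E]
    by (simp add: square_integrable_def expectation_covariation_error prob_space)
  finally have "expectation (\<lambda>\<omega>. (covariation_error p q m k \<omega>)\<^sup>2) \<le> expectation (\<lambda>\<omega>. (?D \<omega>)\<^sup>2)"
    by simp
  also have "\<dots> \<le> 3 / 2 * (1 / 4 ^ m)\<^sup>2 * ((\<Sigma> $ p $ p)\<^sup>2 + (\<Sigma> $ q $ q)\<^sup>2)"
    using D(2) unfolding grid_step .
  finally show ?thesis by (simp only: mult_ac)
qed

text \<open>There are \<open>4 ^ m\<close> orthogonal terms, each with a second moment of order \<open>(4 ^ -m)\<^sup>2\<close>.\<close>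

lemma quadratic_covariation_tendsto:
  "tendsto_L2 M (\<lambda>m \<omega>. \<Sum>k<4 ^ m. covariation_error p q m k \<omega>) (\<lambda>_. 0)"
proof -
  let ?Q = "\<lambda>m \<omega>. \<Sum>k<4 ^ m. covariation_error p q m k \<omega>"
  let ?C = "3 / 2 * ((\<Sigma> $ p $ p)\<^sup>2 + (\<Sigma> $ q $ q)\<^sup>2)"
  have Q: "square_integrable M (?Q m)" for m
    by (intro square_integrable_sum square_integrable_covariation_error)
  have bound: "expectation (\<lambda>\<omega>. (?Q m \<omega>)\<^sup>2) \<le> ?C * (1 / 4) ^ m" for m
  proof -
    have "expectation (\<lambda>\<omega>. (?Q m \<omega>)\<^sup>2)
        = (\<Sum>k<4 ^ m. \<Sum>l<4 ^ m. expectation (\<lambda>\<omega>. covariation_error p q m k \<omega> * covariation_error p q m l \<omega>))"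
      unfolding power2_eq_square sum_product
      by (subst Bochner_Integration.integral_sum)
        (intro Bochner_Integration.integrable_sum square_integrable_mult square_integrable_covariation_error
          sum.cong refl Bochner_Integration.integral_sum)+
    also have "\<dots> = (\<Sum>k<4 ^ m. \<Sum>l<4 ^ m. if l = k then expectation (\<lambda>\<omega>. (covariation_error p q m k \<omega>)\<^sup>2) else 0)"
    proof (intro sum.cong refl)
      fix k l
      show "expectation (\<lambda>\<omega>. covariation_error p q m k \<omega> * covariation_error p q m l \<omega>)
        = (if l = k then expectation (\<lambda>\<omega>. (covariation_error p q m k \<omega>)\<^sup>2) else 0)"
        using covariation_errors_orthogonal[of k l p q m] covariation_errors_orthogonal[of l k p q m]
        by (cases k l rule: linorder_cases) (simp_all add: power2_eq_square mult.commute)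
    qed
    also have "\<dots> = (\<Sum>k<4 ^ m. expectation (\<lambda>\<omega>. (covariation_error p q m k \<omega>)\<^sup>2))"
      by (intro sum.cong refl) (simp add: sum.delta)
    also have "\<dots> \<le> (\<Sum>k<(4::nat) ^ m. ?C * (1 / 4 ^ m)\<^sup>2)"
      by (intro sum_mono covariation_error_bound)
    also have "\<dots> = ?C * (1 / 4) ^ m"
      by (simp add: power2_eq_square power_one_over)
    finally show ?thesis .
  qed
  have "(\<lambda>m. expectation (\<lambda>\<omega>. (?Q m \<omega> - 0)\<^sup>2)) \<longlonglongrightarrow> 0"
  proof (rule tendsto_sandwich)
    show "\<forall>\<^sub>F m in sequentially. 0 \<le> expectation (\<lambda>\<omega>. (?Q m \<omega> - 0)\<^sup>2)"
      by (intro always_eventually allI Bochner_Integration.integral_nonneg) simp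
    show "\<forall>\<^sub>F m in sequentially. expectation (\<lambda>\<omega>. (?Q m \<omega> - 0)\<^sup>2) \<le> ?C * (1 / 4) ^ m"
      unfolding diff_zero by (intro always_eventually allI bound)
    have "(\<lambda>m. ?C * (1 / 4) ^ m) \<longlonglongrightarrow> ?C * 0"
      by (intro tendsto_mult tendsto_const LIMSEQ_power_zero) simp
    then show "(\<lambda>m. ?C * (1 / 4) ^ m) \<longlonglongrightarrow> 0" by (simp only: mult_zero_right)
  qed simp
  then show ?thesis
    using tendsto_L2_iff_integral[OF Q square_integrable_const[of 0]] by (simp only:)
qed

text \<open>Summation of
  \<open>x' y' - x y = x (y' - y) + y (x' - x) + (x' - x) (y' - y)\<close> over the grid cells. This is the
  discrete form of \<open>d(B\<^sub>p B\<^sub>q) = B\<^sub>p dB\<^sub>q + B\<^sub>q dB\<^sub>p + \<sigma>\<^sub>p\<^sub>q dt\<close>.\<close>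

lemma grid_summation_by_parts:
  "B 1 \<omega> $ p * B 1 \<omega> $ q - B 0 \<omega> $ p * B 0 \<omega> $ q
    = grid_integral p q m \<omega> + grid_integral q p m \<omega>
      + ((\<Sum>k<4 ^ m. covariation_error p q m k \<omega>) + \<Sigma> $ p $ q)"
proof -
  let ?b = "\<lambda>r k. B (grid m k) \<omega> $ r"
  have "B 1 \<omega> $ p * B 1 \<omega> $ q - B 0 \<omega> $ p * B 0 \<omega> $ q
      = (\<Sum>k<4 ^ m. ?b p (Suc k) * ?b q (Suc k) - ?b p k * ?b q k)"
    by (subst sum_lessThan_telescope[of "\<lambda>k. ?b p k * ?b q k"]) simp
  also have "\<dots> = (\<Sum>k<4 ^ m. ?b p k * (?b q (Suc k) - ?b q k) + ?b q k * (?b p (Suc k) - ?b p k)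
      + (covariation_error p q m k \<omega> + \<Sigma> $ p $ q / 4 ^ m))"
    by (intro sum.cong refl) (simp only: covariation_error_def, simp add: algebra_simps)
  also have "\<dots> = grid_integral p q m \<omega> + grid_integral q p m \<omega>
      + ((\<Sum>k<4 ^ m. covariation_error p q m k \<omega>) + \<Sigma> $ p $ q)"
    by (simp only: sum.distrib grid_integral_def step_integral_def) simp
  finally show ?thesis .
qed

lemma expectation_grid_integral: "expectation (grid_integral p q m) = 0"
proof -
  have t: "0 \<le> grid m k" "grid m k \<le> grid m (Suc k)" for k by (simp_all only: grid_mono) simp_all
  have past: "(\<lambda>\<omega>. B (grid m k) \<omega> $ p) \<in> borel_measurable (\<F> (grid m k))" for k
    by (intro B_component_adapted t order_refl)
  have "expectation (\<lambda>\<omega>. B (grid m k) \<omega> $ p * incr q (grid m k) (grid m (Suc k)) \<omega>) = 0" for k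
  proof -
    have "expectation (\<lambda>\<omega>. B (grid m k) \<omega> $ p * (\<lambda>x. x $ q) (B (grid m (Suc k)) \<omega> - B (grid m k) \<omega>))
      = expectation (\<lambda>\<omega>. B (grid m k) \<omega> $ p) * expectation (\<lambda>\<omega>. (\<lambda>x. x $ q) (B (grid m (Suc k)) \<omega> - B (grid m k) \<omega>))"
      by (rule indep_past_incr(2)[OF t past])
        (simp_all only: vector_minus_component borel_measurable_nth
          integrable_if_square_integrable[OF square_integrable_B[OF t(1)]]
          integrable_if_square_integrable[OF square_integrable_incr[OF t]])
    then show ?thesis
      by (simp only: vector_minus_component expectation_incr[OF t] mult_zero_right)
  qed
  then show ?thesis
    unfolding grid_integral_def[abs_def] step_integral_def
    by (subst Bochner_Integration.integral_sum)
      (simp_all only: sum.neutral_const integrable_if_square_integrable[OF square_integrable_past_mult_incr[OF t past square_integrable_B[OF t(1)]]])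
qed

lemma expectation_grid_integral_mult:
  "expectation (\<lambda>\<omega>. grid_integral q p m \<omega> * grid_integral q' p m \<omega>)
    = \<Sigma> $ p $ p * \<Sigma> $ q $ q' * (\<Sum>k<4 ^ m. grid m k / 4 ^ m)"
proof -
  have t: "0 \<le> grid m k" "grid m k \<le> grid m (Suc k)" for k by (simp_all only: grid_mono) simp_all
  have past: "(\<lambda>\<omega>. B (grid m k) \<omega> $ r) \<in> borel_measurable (\<F> (grid m k))" for k r
    by (intro B_component_adapted t order_refl)
  let ?X = "\<lambda>r k \<omega>. B (grid m k) \<omega> $ r * incr p (grid m k) (grid m (Suc k)) \<omega>"
  have X: "square_integrable M (?X r k)" for r k
    by (intro square_integrable_past_mult_incr t past square_integrable_B)
  have "expectation (\<lambda>\<omega>. grid_integral q p m \<omega> * grid_integral q' p m \<omega>)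
      = (\<Sum>k<4 ^ m. \<Sum>l<4 ^ m. expectation (\<lambda>\<omega>. ?X q k \<omega> * ?X q' l \<omega>))"
    unfolding grid_integral_def step_integral_def sum_product
    by (subst Bochner_Integration.integral_sum)
      (intro Bochner_Integration.integrable_sum square_integrable_mult X
          sum.cong refl Bochner_Integration.integral_sum)+
  also have "\<dots> = (\<Sum>k<4 ^ m. \<Sum>l<4 ^ m. if l = k then \<Sigma> $ p $ p * \<Sigma> $ q $ q' * (grid m k / 4 ^ m) else 0)"
  proof (intro sum.cong refl)
    fix k l
    have "expectation (\<lambda>\<omega>. ?X q k \<omega> * ?X q' l \<omega>)
      = \<Sigma> $ p $ p * expectation (\<lambda>\<omega>. B (grid m k) \<omega> $ q * B (grid m l) \<omega> $ q')
        * measure lborel ({grid m k<..grid m (Suc k)} \<inter> {grid m l<..grid m (Suc l)})"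
      by (intro expectation_increment_pair t past square_integrable_B)
    also have "\<dots> = (if l = k then \<Sigma> $ p $ p * \<Sigma> $ q $ q' * (grid m k / 4 ^ m) else 0)"
    proof (cases "l = k")
      case True
      then show ?thesis
        by (simp only: Int_absorb covariance_B[OF t(1)] measure_lborel_Ioc[OF t(2)] grid_step if_True) simp
    next
      case False
      then show ?thesis by (simp only: grid_cells_disjoint[OF False[symmetric]] measure_empty if_False mult_zero_right)
    qed
    finally show "expectation (\<lambda>\<omega>. ?X q k \<omega> * ?X q' l \<omega>)
      = (if l = k then \<Sigma> $ p $ p * \<Sigma> $ q $ q' * (grid m k / 4 ^ m) else 0)" .
  qed
  also have "\<dots> = (\<Sum>k<4 ^ m. \<Sigma> $ p $ p * \<Sigma> $ q $ q' * (grid m k / 4 ^ m))"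
    by (intro sum.cong refl) (simp only: sum.delta finite_lessThan if_True)
  also have "\<dots> = \<Sigma> $ p $ p * \<Sigma> $ q $ q' * (\<Sum>k<4 ^ m. grid m k / 4 ^ m)"
    by (simp only: sum_distrib_left)
  finally show ?thesis .
qed

definition centred_tail :: "'n \<Rightarrow> 'n \<Rightarrow> ('w \<Rightarrow> real) \<Rightarrow> 'w \<Rightarrow> real" where
  "centred_tail p q J \<omega> = B 1 \<omega> $ p * B 1 \<omega> $ q - J \<omega> - \<Sigma> $ p $ q"

text \<open>Here the roles of \<open>p\<close> and \<open>q\<close> are exchanged: by the summation by parts, subtracting the sums for
  \<open>\<integral> B\<^sub>p dB\<^sub>q\<close> from \<open>B\<^sub>p(1) B\<^sub>q(1) - \<sigma>\<^sub>p\<^sub>q\<close> leaves the sums for \<open>\<integral> B\<^sub>q dB\<^sub>p\<close>, up to the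
  vanishing covariation error. Integrals against different \<open>B\<^sub>q\<close> become integrals against the
  same \<open>B\<^sub>p\<close>.\<close>

lemma grid_integral_tendsto_centred_tail:
  assumes J: "has_ito_integral M \<F> (\<lambda>s \<omega>. B s \<omega> $ q) 1 (\<lambda>s \<omega>. B s \<omega> $ p) J"
  shows "centred_tail p q J \<in> borel_measurable M"
    and "tendsto_L2 M (grid_integral q p) (centred_tail p q J)"
proof -
  have [measurable]: "J \<in> borel_measurable M" using J by (simp add: has_ito_integral_def)
  have [measurable]: "(\<lambda>\<omega>. B 1 \<omega> $ r) \<in> borel_measurable M" for r
    by (rule B_component_measurable) simp
  note [measurable] = grid_integral_measurable
  show Z [measurable]: "centred_tail p q J \<in> borel_measurable M"
    unfolding centred_tail_def[abs_def] by measurable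
  show "tendsto_L2 M (grid_integral q p) (centred_tail p q J)"
  proof (rule tendsto_L2_if_difference_vanishes)
    show "tendsto_L2 M (\<lambda>m. centred_tail p q (grid_integral p q m)) (centred_tail p q J)"
    proof -
      have "centred_tail p q (grid_integral p q m) \<omega> - centred_tail p q J \<omega> = - (grid_integral p q m \<omega> - J \<omega>)" for m \<omega>
        by (simp add: centred_tail_def)
      then show ?thesis
        using grid_integral_tendsto_Ito_integral[OF J] by (simp only: tendsto_L2_def power2_minus)
    qed
    show "(\<lambda>m. \<integral>\<^sup>+\<omega>. ennreal ((grid_integral q p m \<omega> - centred_tail p q (grid_integral p q m) \<omega>)\<^sup>2) \<partial>M) \<longlonglongrightarrow> 0"
    proof -
      have "(\<integral>\<^sup>+\<omega>. ennreal ((grid_integral q p m \<omega> - centred_tail p q (grid_integral p q m) \<omega>)\<^sup>2) \<partial>M)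
        = (\<integral>\<^sup>+\<omega>. ennreal (((\<Sum>k<4 ^ m. covariation_error p q m k \<omega>) - 0)\<^sup>2) \<partial>M)" for m
      proof (rule nn_integral_cong_AE)
        show "AE \<omega> in M. ennreal ((grid_integral q p m \<omega> - centred_tail p q (grid_integral p q m) \<omega>)\<^sup>2)
          = ennreal (((\<Sum>k<4 ^ m. covariation_error p q m k \<omega>) - 0)\<^sup>2)"
          using B_0
        proof eventually_elim
          fix \<omega> assume "B 0 \<omega> = 0"
          then have "B 0 \<omega> $ p * B 0 \<omega> $ q = 0" by simp
          then have "grid_integral q p m \<omega> - centred_tail p q (grid_integral p q m) \<omega>
              = - ((\<Sum>k<4 ^ m. covariation_error p q m k \<omega>) - 0)"
            using grid_summation_by_parts[of \<omega> p q m] unfolding centred_tail_def by linarith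
          then show "ennreal ((grid_integral q p m \<omega> - centred_tail p q (grid_integral p q m) \<omega>)\<^sup>2)
            = ennreal (((\<Sum>k<4 ^ m. covariation_error p q m k \<omega>) - 0)\<^sup>2)"
            by (simp only: power2_minus)
        qed
      qed
      then show ?thesis
        using quadratic_covariation_tendsto[of p q] by (simp only: tendsto_L2_def)
    qed
    show "centred_tail p q (grid_integral p q m) \<in> borel_measurable M" for m
      unfolding centred_tail_def[abs_def] by measurable
  qed (rule grid_integral_measurable Z)+
qed

lemma centred_tail_moments:
  assumes J: "has_ito_integral M \<F> (\<lambda>s \<omega>. B s \<omega> $ q) 1 (\<lambda>s \<omega>. B s \<omega> $ p) J"
    and J': "has_ito_integral M \<F> (\<lambda>s \<omega>. B s \<omega> $ q') 1 (\<lambda>s \<omega>. B s \<omega> $ p) J'"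
  shows "square_integrable M (centred_tail p q J)"
    and "expectation (centred_tail p q J) = 0"
    and "expectation (\<lambda>\<omega>. centred_tail p q J \<omega> * centred_tail p q' J' \<omega>) = \<Sigma> $ p $ p * \<Sigma> $ q $ q' / 2"
proof -
  have sq: "square_integrable M (centred_tail p r I)"
    if "has_ito_integral M \<F> (\<lambda>s \<omega>. B s \<omega> $ r) 1 (\<lambda>s \<omega>. B s \<omega> $ p) I" for r I
    by (rule tendsto_L2_square_integrable[OF square_integrable_grid_integral
          grid_integral_tendsto_centred_tail[OF that]])
  note lim = grid_integral_tendsto_centred_tail(2)
  show "square_integrable M (centred_tail p q J)" by (rule sq[OF J])
  have "tendsto_L2 M (\<lambda>_ _. 1) (\<lambda>_. 1)" by (simp add: tendsto_L2_def)
  then have "(\<lambda>m. expectation (\<lambda>\<omega>. grid_integral q p m \<omega> * 1)) \<longlonglongrightarrow> expectation (\<lambda>\<omega>. centred_tail p q J \<omega> * 1)"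
    by (rule tendsto_L2_inner[OF square_integrable_grid_integral square_integrable_const sq[OF J]
          square_integrable_const lim[OF J]])
  then have "(\<lambda>m::nat. 0) \<longlonglongrightarrow> expectation (centred_tail p q J)"
    by (simp only: mult_1_right expectation_grid_integral)
  then show "expectation (centred_tail p q J) = 0"
    by (rule LIMSEQ_unique[OF _ tendsto_const])
  have "(\<lambda>m. expectation (\<lambda>\<omega>. grid_integral q p m \<omega> * grid_integral q' p m \<omega>))
      \<longlonglongrightarrow> expectation (\<lambda>\<omega>. centred_tail p q J \<omega> * centred_tail p q' J' \<omega>)"
    by (rule tendsto_L2_inner[OF square_integrable_grid_integral square_integrable_grid_integral
          sq[OF J] sq[OF J'] lim[OF J] lim[OF J']])
  moreover have "(\<lambda>m. expectation (\<lambda>\<omega>. grid_integral q p m \<omega> * grid_integral q' p m \<omega>))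
      \<longlonglongrightarrow> \<Sigma> $ p $ p * \<Sigma> $ q $ q' * (1 / 2)"
    unfolding expectation_grid_integral_mult by (intro tendsto_mult tendsto_const sum_grid_tendsto)
  ultimately show "expectation (\<lambda>\<omega>. centred_tail p q J \<omega> * centred_tail p q' J' \<omega>) = \<Sigma> $ p $ p * \<Sigma> $ q $ q' / 2"
    using LIMSEQ_unique by fastforce
qed

end

theorem lemma5p1:
  fixes M :: "'w measure"
    and \<Sigma> :: "real ^ 'd::finite option ^ 'd option"
    and B :: "real \<Rightarrow> 'w \<Rightarrow> real ^ 'd option"
  assumes "brownian_motion M \<Sigma> B"
  shows "(\<forall>i. integrable M (\<lambda>\<omega>. (tail_integral M B \<omega> $ i)\<^sup>2)) \<and>
         (\<forall>i j. covariance_matrix M (tail_integral M B) $ i $ j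
                  = \<Sigma> $ None $ None * \<Sigma> $ Some i $ Some j / 2)"
proof -
  interpret brownian M \<Sigma> B
    using assms by (intro brownian.intro brownian_axioms.intro) (simp_all add: brownian_motion_def)
  define J where "J i = ito_integral M \<F> (\<lambda>s \<omega>. B s \<omega> $ Some i) 1 (\<lambda>s \<omega>. B s \<omega> $ None)" for i
  have J: "has_ito_integral M \<F> (\<lambda>s \<omega>. B s \<omega> $ Some i) 1 (\<lambda>s \<omega>. B s \<omega> $ None) (J i)" for i
    unfolding J_def ito_integral_def by (rule someI_ex[OF Ito_integral_exists])
  let ?Z = "\<lambda>i. centred_tail None (Some i) (J i)"
  have tail: "tail_integral M B \<omega> $ i = ?Z i \<omega> + \<Sigma> $ None $ Some i" for \<omega> i
    by (simp add: tail_integral_def ito_integral_vec_def hat_def centred_tail_def J_def)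
  have Z: "square_integrable M (?Z i)" "expectation (?Z i) = 0" for i
    by (rule centred_tail_moments[OF J J])+
  have mean: "expectation (\<lambda>\<omega>. tail_integral M B \<omega> $ i) = \<Sigma> $ None $ Some i" for i
    unfolding tail
    by (subst Bochner_Integration.integral_add)
      (simp_all add: integrable_if_square_integrable[OF Z(1)] Z(2) prob_space)
  have "integrable M (\<lambda>\<omega>. (tail_integral M B \<omega> $ i)\<^sup>2)" for i
    using square_integrable_add[OF Z(1) square_integrable_const] unfolding tail square_integrable_def
    by blast
  moreover have "covariance_matrix M (tail_integral M B) $ i $ j
      = \<Sigma> $ None $ None * \<Sigma> $ Some i $ Some j / 2" for i j
    unfolding covariance_matrix_def vec_lambda_beta mean
    unfolding tail add_diff_cancel_right' by (rule centred_tail_moments(3)[OF J J])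
  ultimately show ?thesis by blast
qed

end
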